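(* Let $\mathcal{V}$ be a ground set with $|\mathcal{V}|=n$, let $f:2^{\mathcal{V}}\to\mathbb{R}_{\ge 0}$ be a monotone submodular function accessible only through a value oracle, and let $w:\mathcal{V}\to\mathbb{R}_{>0}$ be a weight function with weight ratio $\rho:=\frac{\max_{v\in\mathcal{V}}w(v)}{\min_{v\in\mathcal{V}}w(v)}$. Consider a sequence of updates, each being the insertion or the deletion of an element of $\mathcal{V}$, fixed in advance by an oblivious adversary, and let $V_t\subseteq\mathcal{V}$ be the set of currently present elements after the first $t$ updates. Then for every sufficiently small $\epsilon>0$ there is a randomized algorithm that, after every update $t$, maintains a set $S_t\subseteq V_t$ such that $$\mathbb{E}[f(S_t)]\ge (1-O(\epsilon))\,f(V_t)\quad\text{and}\quad \mathrm{Cost}(S_t)\le O(\epsilon^{-1})\,\mathrm{OPT}_t,$$ i.e. $S_t$ is an expected $(1-O(\epsilon),O(\epsilon^{-1}))$-bicriteria approximate solution, and whose expected amortized number of oracle queries per update is at most $\mathrm{poly}(\log n,\log\rho,\epsilon^{-1})$.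
   Context: For $S\subseteq\mathcal{V}$, $\mathrm{Cost}(S):=\sum_{v\in S}w(v)$. The dynamic submodular cover problem at time $t$ asks for $S\subseteq V_t$ of minimum cost with $f(S)=f(V_t)$; $\mathrm{OPT}_t:=\min\{\mathrm{Cost}(S): S\subseteq V_t,\ f(S)=f(V_t)\}$. A (random) set $S\subseteq V_t$ is an expected $(1-\epsilon',c)$-bicriteria approximate solution if $\mathbb{E}[f(S)]\ge(1-\epsilon')f(V_t)$ and $\mathrm{Cost}(S)\le c\cdot\mathrm{OPT}_t$. An oblivious adversary knows the algorithm but not its random bits, equivalently the whole update sequence is fixed before the algorithm runs. Query complexity counts calls to the oracle returning $f(A)$ for a queried set $A\subseteq\mathcal{V}$; amortized means total number of queries over the first $t$ updates divided by $t$. *)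

theory Defs
  imports "HOL-Probability.Probability"
begin

datatype upd = Ins nat | Del nat

primrec upd_elem :: "upd \<Rightarrow> nat" where
  "upd_elem (Ins x) = x"
| "upd_elem (Del x) = x"

primrec cur :: "(nat \<Rightarrow> upd) \<Rightarrow> nat \<Rightarrow> nat set" where
  "cur u 0 = {}"
| "cur u (Suc t) = (case u t of Ins x \<Rightarrow> insert x (cur u t) | Del x \<Rightarrow> cur u t - {x})"

definition cost :: "(nat \<Rightarrow> real) \<Rightarrow> nat set \<Rightarrow> real" where
  "cost w S = (\<Sum>v\<in>S. w v)"

definition OPT :: "(nat set \<Rightarrow> real) \<Rightarrow> (nat \<Rightarrow> real) \<Rightarrow> nat set \<Rightarrow> real" where
  "OPT f w Vt = Min (cost w ` {S. S \<subseteq> Vt \<and> f S = f Vt})"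

definition wratio :: "(nat \<Rightarrow> real) \<Rightarrow> nat set \<Rightarrow> real" where
  "wratio w V = Max (w ` V) / Min (w ` V)"

definition monotone_submodular :: "(nat set \<Rightarrow> real) \<Rightarrow> nat set \<Rightarrow> bool" where
  "monotone_submodular f V \<longleftrightarrow>
     (\<forall>A. A \<subseteq> V \<longrightarrow> f A \<ge> 0) \<and>
     (\<forall>A B. A \<subseteq> B \<and> B \<subseteq> V \<longrightarrow> f A \<le> f B) \<and>
     (\<forall>A B. A \<subseteq> V \<and> B \<subseteq> V \<longrightarrow> f (A \<union> B) + f (A \<inter> B) \<le> f A + f B)"

datatype event = EUpd upd | EAns "nat set" real | ERnd nat

fun is_EAns :: "event \<Rightarrow> bool" where
  "is_EAns (EAns _ _) = True"
| "is_EAns _ = False"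

definition num_queries :: "event list \<Rightarrow> nat" where
  "num_queries tr = length (filter is_EAns tr)"

datatype 'r comp = Ret 'r | Qry "nat set" "real \<Rightarrow> 'r comp" | Samp "nat pmf" "nat \<Rightarrow> 'r comp"

primrec run_comp :: "(nat set \<Rightarrow> real) \<Rightarrow> 'r comp \<Rightarrow> (event list \<times> 'r) pmf" where
  "run_comp f (Ret r) = return_pmf ([], r)"
| "run_comp f (Qry A k) =
     map_pmf (\<lambda>(es, r). (EAns A (f A) # es, r)) (run_comp f (k (f A)))"
| "run_comp f (Samp p k) =
     bind_pmf p (\<lambda>i. map_pmf (\<lambda>(es, r). (ERnd i # es, r)) (run_comp f (k i)))"

(* Running an algorithm (a function from the transcript so far, ending with the
   current update, to an oracle computation producing S_t) on a fixed update
   sequence u.  Result after t updates: distribution of (transcript, S_t). *)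
primrec exec :: "(nat set \<Rightarrow> real) \<Rightarrow> (event list \<Rightarrow> nat set comp) \<Rightarrow> (nat \<Rightarrow> upd)
                  \<Rightarrow> nat \<Rightarrow> (event list \<times> nat set) pmf" where
  "exec f alg u 0 = return_pmf ([], {})"
| "exec f alg u (Suc t) =
     bind_pmf (exec f alg u t) (\<lambda>(tr, _).
       map_pmf (\<lambda>(es, S). (tr @ [EUpd (u t)] @ es, S)) (run_comp f (alg (tr @ [EUpd (u t)]))))"

end

theory Submission
  imports Defs
begin

text \<open>Guess \<open>c\<close> close to \<open>OPT\<close> and put \<open>\<tau> = \<epsilon> * f V\<^sub>t / c\<close>. If every element of \<open>S\<close> was added with
  marginal gain at least \<open>\<tau>\<close> times its weight, then \<open>S\<close> costs at most \<open>f V\<^sub>t / \<tau> = c / \<epsilon>\<close>; if no other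
  element has such a gain, then \<open>f V\<^sub>t - f S \<le> \<tau> * OPT\<close>. So it suffices to maintain, for each power
  of two \<open>\<tau>\<close>, a set that is maximal for the density threshold \<open>\<tau>\<close>, and to output the set of the
  largest threshold that keeps a fraction \<open>1 - \<epsilon>\<close> of the value.

  Such a set is built in levels. A level holds all candidates that still exceed the threshold, picks
  the largest class of candidates with gains equal up to a factor of two, and adds random elements of
  that class until a quarter of it has dropped to a lower class. Few levels exhaust the candidates. A
  level and its successors are rebuilt when the number of updates exceeds a small fraction of the
  candidates, which amortizes the queries. Until then deleted elements are not replaced: the updates
  do not depend on the random choices, so in expectation they hit only a small fraction of the gain
  of each batch.\<close>

section \<open>Oracle computations\<close>

text \<open>Deleted elements stay in their batches, and later gains are measured relative to them;
  only the output is intersected with the current set. This separates two guarantees. Cost is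
  bounded in every run: gains credited to a batch are hereditary (\<open>admissible\<close>), so the
  survivors alone still pay for their weights. Value is bounded in expectation: by the factor-two
  classes a vanished element costs at most \<open>2 * a\<close>, while each chosen one contributed
  at least \<open>a\<close>, so it suffices that few chosen elements are hit. The obstacle is that
  candidate sets depend on earlier random choices, so rebuilding times are random. For one fixed
  target time, however, the set of coming updates is fixed in advance, and as soon as the candidates
  of a level are known it is determined whether its own count of updates forces a rebuild before
  then; only its batch is still random. The tolerance \<open>\<epsilon> / (32 * B ^ 3)\<close>
  serves two ends: tolerated updates must not undo the potential drop of order
  \<open>1 / B ^ 2\<close> per level, and expected losses of order \<open>\<delta> * B\<close> per
  threshold are summed over up to \<open>B\<close> thresholds.\<close>

primrec bind_comp :: "'a comp \<Rightarrow> ('a \<Rightarrow> 'b comp) \<Rightarrow> 'b comp" where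
  "bind_comp (Ret r) g = g r"
| "bind_comp (Qry A k) g = Qry A (\<lambda>y. bind_comp (k y) g)"
| "bind_comp (Samp p k) g = Samp p (\<lambda>i. bind_comp (k i) g)"

lemma run_comp_bind:
  "run_comp f (bind_comp c g) =
     bind_pmf (run_comp f c) (\<lambda>(es, r). map_pmf (\<lambda>(es', r'). (es @ es', r')) (run_comp f (g r)))"
proof (induction c)
  case (Ret r)
  then show ?case by (simp add: bind_return_pmf case_prod_unfold)
next
  case (Qry A k)
  then show ?case
    by (simp add: map_bind_pmf bind_map_pmf case_prod_unfold map_pmf_comp)
next
  case (Samp p k)
  then show ?case
    by (simp add: map_bind_pmf bind_map_pmf bind_assoc_pmf case_prod_unfold map_pmf_comp)
qed

definition result :: "(nat set \<Rightarrow> real) \<Rightarrow> 'r comp \<Rightarrow> 'r pmf" where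
  "result f c = map_pmf snd (run_comp f c)"

lemma result_Ret [simp]: "result f (Ret r) = return_pmf r"
  and result_Qry [simp]: "result f (Qry A k) = result f (k (f A))"
  and result_Samp [simp]: "result f (Samp p k') = bind_pmf p (\<lambda>i. result f (k' i))"
  by (simp_all add: result_def map_pmf_comp case_prod_unfold map_bind_pmf)

lemma result_bind [simp]:
  "result f (bind_comp c g) = bind_pmf (result f c) (\<lambda>r. result f (g r))"
  by (simp add: result_def run_comp_bind map_bind_pmf bind_map_pmf case_prod_unfold map_pmf_comp)

text \<open>A Hoare-style judgement over all possible runs. Query count and result are constrained
  jointly, since the amortization trades one against the other.\<close>

definition runs :: "(nat set \<Rightarrow> real) \<Rightarrow> 'r comp \<Rightarrow> (nat \<Rightarrow> 'r \<Rightarrow> bool) \<Rightarrow> bool" where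
  "runs f c Q \<longleftrightarrow> (\<forall>(es, r) \<in> set_pmf (run_comp f c). Q (num_queries es) r)"

lemma num_queries_simps [simp]:
  "num_queries [] = 0"
  "num_queries (EAns A y # es) = Suc (num_queries es)"
  "num_queries (ERnd i # es) = num_queries es"
  "num_queries (EUpd u # es) = num_queries es"
  "num_queries (es @ es') = num_queries es + num_queries es'"
  by (simp_all add: num_queries_def)

lemma runs_Ret [simp]: "runs f (Ret r) Q \<longleftrightarrow> Q 0 r"
  and runs_Qry [simp]: "runs f (Qry A k) Q \<longleftrightarrow> runs f (k (f A)) (\<lambda>n. Q (Suc n))"
  and runs_Samp [simp]: "runs f (Samp p k') Q \<longleftrightarrow> (\<forall>i\<in>set_pmf p. runs f (k' i) Q)"
  by (auto simp: runs_def case_prod_unfold)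

lemma runs_bind [simp]:
  "runs f (bind_comp c g) Q \<longleftrightarrow> runs f c (\<lambda>n r. runs f (g r) (\<lambda>m. Q (n + m)))"
  unfolding runs_def run_comp_bind by fastforce

lemma runs_mono: "runs f c Q \<Longrightarrow> (\<And>n r. Q n r \<Longrightarrow> Q' n r) \<Longrightarrow> runs f c Q'"
  by (auto simp: runs_def)

lemma runs_result: "runs f c (\<lambda>_. Q) \<longleftrightarrow> (\<forall>r\<in>set_pmf (result f c). Q r)"
  by (auto simp: runs_def result_def case_prod_unfold)

primrec query_all :: "nat set list \<Rightarrow> (nat set \<Rightarrow> real) comp" where
  "query_all [] = Ret (\<lambda>_. 0)"
| "query_all (A # As) = Qry A (\<lambda>y. bind_comp (query_all As) (\<lambda>h. Ret (h(A := y))))"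

text \<open>The answers form a set function, so that \<open>live\<close>, \<open>idx\<close> and
  \<open>bucket\<close> can be evaluated on them by the algorithm and on \<open>f\<close> by the
  analysis; the lemmas on \<open>probe\<close> identify the two.\<close>

definition answers :: "(nat set \<Rightarrow> real) \<Rightarrow> nat set list \<Rightarrow> nat set \<Rightarrow> real" where
  "answers f As = (\<lambda>A. if A \<in> set As then f A else 0)"

lemma answers_Cons: "(answers f As)(A := f A) = answers f (A # As)"
  by (auto simp: answers_def)

lemma runs_query_all [simp]: "runs f (query_all As) Q \<longleftrightarrow> Q (length As) (answers f As)"
proof (induction As arbitrary: Q)
  case Nil
  then show ?case by (simp add: answers_def)
next
  case (Cons A As)
  then show ?case by (simp add: answers_Cons)
qed

lemma result_query_all [simp]: "result f (query_all As) = return_pmf (answers f As)"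
proof (induction As)
  case Nil
  then show ?case by (simp add: answers_def)
next
  case (Cons A As)
  then show ?case by (simp add: bind_return_pmf answers_Cons)
qed

text \<open>Finite support is part of the judgement because the integral of a non-integrable
  function is 0 by convention; with finite support every real function is integrable.\<close>

definition expects :: "(nat set \<Rightarrow> real) \<Rightarrow> 'r comp \<Rightarrow> ('r \<Rightarrow> real) \<Rightarrow> real \<Rightarrow> bool" where
  "expects f c h b \<longleftrightarrow>
     finite (set_pmf (result f c)) \<and> measure_pmf.expectation (result f c) h \<le> b"

lemma expectation_bind_le:
  fixes h :: "'b \<Rightarrow> real"
  assumes "finite (set_pmf p)"
    and "\<And>x. x \<in> set_pmf p \<Longrightarrow> finite (set_pmf (g x))"
    and "\<And>x. x \<in> set_pmf p \<Longrightarrow> measure_pmf.expectation (g x) h \<le> h' x"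
  shows "measure_pmf.expectation (bind_pmf p g) h \<le> measure_pmf.expectation p h'"
proof -
  have "measure_pmf.expectation (bind_pmf p g) h =
      (\<Sum>a\<in>set_pmf p. pmf p a *\<^sub>R measure_pmf.expectation (g a) h)"
    using assms by (intro pmf_expectation_bind) auto
  also have "\<dots> \<le> (\<Sum>a\<in>set_pmf p. pmf p a *\<^sub>R h' a)"
    using assms(3) by (intro sum_mono) (auto intro!: mult_left_mono)
  also have "\<dots> = measure_pmf.expectation p h'"
    using assms(1) by (simp add: integral_measure_pmf_real[where A = "set_pmf p"] mult.commute)
  finally show ?thesis .
qed

lemma expects_Ret [simp]: "expects f (Ret r) h b \<longleftrightarrow> h r \<le> b"
  by (simp add: expects_def)

text \<open>Tower property, with \<open>h'\<close> as the potential that links the two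
  computations.\<close>

lemma expects_bind:
  assumes "expects f c h' b" and "runs f c (\<lambda>_ r. expects f (g r) h (h' r))"
  shows "expects f (bind_comp c g) h b"
proof -
  have *: "\<And>r. r \<in> set_pmf (result f c) \<Longrightarrow> expects f (g r) h (h' r)"
    using assms(2) by (simp add: runs_result)
  have "measure_pmf.expectation (bind_pmf (result f c) (\<lambda>r. result f (g r))) h
      \<le> measure_pmf.expectation (result f c) h'"
    using assms(1) * by (intro expectation_bind_le) (auto simp: expects_def)
  then show ?thesis
    using assms(1) * by (auto simp: expects_def)
qed

lemma expects_query_all [simp]:
  "expects f (bind_comp (query_all As) g) h b \<longleftrightarrow> expects f (g (answers f As)) h b"
  by (simp add: expects_def bind_return_pmf)

lemma expects_Samp_uniform:
  fixes b :: real
  assumes "finite A" "A \<noteq> {}"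
    and "\<And>e. e \<in> A \<Longrightarrow> expects f (k e) h (b' e)"
    and "(\<Sum>e\<in>A. b' e) \<le> b * card A"
  shows "expects f (Samp (pmf_of_set A) k) h b"
proof -
  have "measure_pmf.expectation (bind_pmf (pmf_of_set A) (\<lambda>i. result f (k i))) h
      \<le> measure_pmf.expectation (pmf_of_set A) b'"
    using assms by (intro expectation_bind_le) (auto simp: expects_def)
  also have "\<dots> \<le> b"
    using assms by (simp add: integral_pmf_of_set divide_le_eq card_gt_0_iff)
  finally show ?thesis
    using assms by (auto simp: expects_def)
qed

lemma expects_cmult:
  assumes "expects f c h 0" "0 \<le> k"
  shows "expects f c (\<lambda>r. k * h r) 0"
  using assms by (simp add: expects_def mult_nonneg_nonpos)

lemma expects_bind_Ret:
  assumes e: "expects f c h b" and le: "\<And>r. h' (g r) \<le> h r + k"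
  shows "expects f (bind_comp c (\<lambda>r. Ret (g r))) h' (b + k)"
proof (rule expects_bind[where h' = "\<lambda>r. h r + k"])
  show "expects f c (\<lambda>r. h r + k) (b + k)"
    using e by (auto simp: expects_def integrable_measure_pmf_finite)
  show "runs f c (\<lambda>_ r. expects f (Ret (g r)) h' (h r + k))"
    using le by (auto simp: runs_def)
qed

section \<open>Random batches of elements with a large marginal gain\<close>

definition live :: "(nat set \<Rightarrow> real) \<Rightarrow> (nat \<Rightarrow> real) \<Rightarrow> nat set \<Rightarrow> nat \<Rightarrow> bool" where
  "live f \<theta> S v \<longleftrightarrow> \<theta> v \<le> f (insert v S) - f S"

definition probe :: "nat set \<Rightarrow> nat set \<Rightarrow> nat set list" where
  "probe S X = S # map (\<lambda>v. insert v S) (sorted_list_of_set X)"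

lemma length_probe [simp]: "finite X \<Longrightarrow> length (probe S X) = Suc (card X)"
  by (simp add: probe_def)

lemma answers_probe [simp]:
  "answers f (probe S X) S = f S"
  "finite X \<Longrightarrow> v \<in> X \<Longrightarrow> answers f (probe S X) (insert v S) = f (insert v S)"
  by (auto simp: answers_def probe_def)

lemma live_probe [simp]:
  "finite X \<Longrightarrow> v \<in> X \<Longrightarrow> live (answers f (probe S X)) \<theta> S v = live f \<theta> S v"
  by (simp add: live_def)

text \<open>Sampling without replacement: a drawn element leaves \<open>X\<close> whether or not it
  is accepted into \<open>M\<close>.\<close>

primrec draw :: "nat set \<Rightarrow> (nat \<Rightarrow> real) \<Rightarrow> nat \<Rightarrow> nat set \<Rightarrow> nat set \<Rightarrow> (nat set \<times> nat set) comp" where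
  "draw S \<theta> 0 M X = Ret (M, X)"
| "draw S \<theta> (Suc n) M X =
     Samp (pmf_of_set X) (\<lambda>e. bind_comp (query_all (probe (S \<union> M) {e})) (\<lambda>h.
       draw S \<theta> n (if live h \<theta> (S \<union> M) e then insert e M else M) (X - {e})))"

definition lively :: "(nat set \<Rightarrow> real) \<Rightarrow> (nat \<Rightarrow> real) \<Rightarrow> nat set \<Rightarrow> nat set \<Rightarrow> bool" where
  "lively f \<theta> S A \<longleftrightarrow> 3 * card A < 4 * card {v \<in> A. live f \<theta> S v}"

text \<open>Testing how much of \<open>A\<close> is still live takes a query per element, so the test is made only after
  1, 2, 4, \<dots> draws. The last batch of draws may thus be biased towards elements that do not lose
  their gain, but it has at most as many draws as were made before it, when most of \<open>A\<close> was live.\<close>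

primrec extend :: "nat set \<Rightarrow> (nat \<Rightarrow> real) \<Rightarrow> nat set \<Rightarrow> nat \<Rightarrow> nat \<Rightarrow> nat set \<Rightarrow> nat set \<Rightarrow> nat set comp" where
  "extend S \<theta> A 0 j M X = Ret M"
| "extend S \<theta> A (Suc K) j M X =
     bind_comp (query_all (probe (S \<union> M) A)) (\<lambda>h.
       if lively h \<theta> (S \<union> M) A
       then bind_comp (draw S \<theta> j M X) (\<lambda>(M', X'). extend S \<theta> A K (2 * j) M' X')
       else Ret M)"

text \<open>One unconditional draw lets \<open>extend\<close> start with \<open>j = 1\<close>; from
  then on \<open>j\<close> is the number of draws made so far.\<close>

definition stage :: "nat set \<Rightarrow> (nat \<Rightarrow> real) \<Rightarrow> nat set \<Rightarrow> nat \<Rightarrow> nat set comp" where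
  "stage S \<theta> A K = bind_comp (draw S \<theta> 1 {} A) (\<lambda>(M, X). extend S \<theta> A K 1 M X)"

lemma lively_probe [simp]:
  assumes "finite A"
  shows "lively (answers f (probe S A)) \<theta> S A = lively f \<theta> S A"
proof -
  have "{v \<in> A. live (answers f (probe S A)) \<theta> S v} = {v \<in> A. live f \<theta> S v}"
    using assms by auto
  then show ?thesis by (simp add: lively_def)
qed

section \<open>Submodularity: diminishing and hereditary gains\<close>

locale submodular =
  fixes f :: "nat set \<Rightarrow> real" and V :: "nat set"
  assumes finite_V: "finite V" and submod: "monotone_submodular f V"
begin

lemma nonneg: "A \<subseteq> V \<Longrightarrow> 0 \<le> f A"
  using submod by (simp add: monotone_submodular_def)

lemma mono: "A \<subseteq> B \<Longrightarrow> B \<subseteq> V \<Longrightarrow> f A \<le> f B"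
  using submod by (simp add: monotone_submodular_def)

lemma union_inter_le: "A \<subseteq> V \<Longrightarrow> B \<subseteq> V \<Longrightarrow> f (A \<union> B) + f (A \<inter> B) \<le> f A + f B"
  using submod by (simp add: monotone_submodular_def)

lemma gain_antimono:
  assumes "S \<subseteq> T" "T \<subseteq> V" "v \<in> V"
  shows "f (insert v T) - f T \<le> f (insert v S) - f S"
proof (cases "v \<in> T")
  case True
  then show ?thesis
    using mono[of S "insert v S"] assms by (simp add: insert_absorb subset_insertI)
next
  case False
  have "f (insert v S \<union> T) + f (insert v S \<inter> T) \<le> f (insert v S) + f T"
    using assms by (intro union_inter_le) auto
  moreover have "insert v S \<union> T = insert v T" "insert v S \<inter> T = S"
    using assms False by auto
  ultimately show ?thesis by simp
qed

lemma live_antimono: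
  "live f \<theta> T v \<Longrightarrow> S \<subseteq> T \<Longrightarrow> T \<subseteq> V \<Longrightarrow> v \<in> V \<Longrightarrow> live f \<theta> S v"
  using gain_antimono[of S T v] by (simp add: live_def)

lemma not_live_member: "v \<in> S \<Longrightarrow> 0 < \<theta> v \<Longrightarrow> \<not> live f \<theta> S v"
  by (simp add: live_def insert_absorb)

text \<open>Gains are measured at \<open>S\<close> although \<open>D\<close> joins the larger set
  \<open>T\<close>: lost elements will be charged the gain they had when their batch was
  begun.\<close>

lemma union_le_sum_gains:
  assumes "S \<subseteq> T" "T \<subseteq> V" "D \<subseteq> V"
  shows "f (T \<union> D) - f T \<le> (\<Sum>v\<in>D. f (insert v S) - f S)"
proof -
  have "finite D" using assms finite_V finite_subset by blast
  then show ?thesis using assms(3)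
  proof (induction D)
    case empty
    then show ?case by simp
  next
    case (insert x D)
    have "f (insert x (T \<union> D)) - f (T \<union> D) \<le> f (insert x S) - f S"
      using insert.prems assms by (intro gain_antimono) auto
    moreover have "f (T \<union> D) - f T \<le> (\<Sum>v\<in>D. f (insert v S) - f S)"
      using insert by auto
    ultimately show ?case using insert.hyps by simp
  qed
qed

text \<open>Elements of \<open>S\<close> and of \<open>M\<close> may be deleted later. Quantifying
  over all subsets \<open>Z\<close> and \<open>K\<close> gives the gain for whatever survives; the
  inequality for \<open>S\<close> and \<open>M\<close> alone would not pass to subsets.\<close>

definition admissible :: "nat set \<Rightarrow> (nat \<Rightarrow> real) \<Rightarrow> nat set \<Rightarrow> bool" where
  "admissible S \<theta> M \<longleftrightarrow> (\<forall>Z K. Z \<subseteq> S \<longrightarrow> K \<subseteq> M \<longrightarrow> f Z + sum \<theta> K \<le> f (Z \<union> K))"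

lemma admissibleD: "admissible S \<theta> M \<Longrightarrow> Z \<subseteq> S \<Longrightarrow> K \<subseteq> M \<Longrightarrow> f Z + sum \<theta> K \<le> f (Z \<union> K)"
  by (simp add: admissible_def)

lemma admissible_empty [simp]: "admissible S \<theta> {}"
  by (simp add: admissible_def)

lemma admissible_insert:
  assumes "admissible S \<theta> M" "live f \<theta> (S \<union> M) e" "S \<subseteq> V" "M \<subseteq> V" "e \<in> V"
  shows "admissible S \<theta> (insert e M)"
  unfolding admissible_def
proof (intro allI impI)
  fix Z K assume Z: "Z \<subseteq> S" and K: "K \<subseteq> insert e M"
  show "f Z + sum \<theta> K \<le> f (Z \<union> K)"
  proof (cases "e \<in> K")
    case False
    then show ?thesis using Z K by (intro admissibleD[OF assms(1)]) auto
  next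
    case True
    have fin: "finite K" using K assms(4,5) finite_V by (meson finite_subset insert_subset)
    let ?K = "K - {e}"
    have "f Z + sum \<theta> ?K \<le> f (Z \<union> ?K)"
      using Z K by (intro admissibleD[OF assms(1)]) auto
    \<comment> \<open>\<open>e\<close> may be counted as the last element added, because its gain
      over a smaller set is at least its gain over \<open>S \<union> M\<close>.\<close>
    moreover have "live f \<theta> (Z \<union> ?K) e"
      using assms Z K by (intro live_antimono[OF assms(2)]) auto
    moreover have "insert e (Z \<union> ?K) = Z \<union> K" using True by auto
    moreover have "sum \<theta> K = \<theta> e + sum \<theta> ?K"
      using fin True by (simp add: sum.remove)
    ultimately show ?thesis by (simp add: live_def)
  qed
qed

end

section \<open>Analysis of one batch: queries and expected number of updated elements\<close>

locale batching = submodular +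
  fixes S A :: "nat set" and \<theta> :: "nat \<Rightarrow> real"
  assumes S_sub: "S \<subseteq> V" and A_sub: "A \<subseteq> V" and \<theta>_pos: "\<And>v. v \<in> V \<Longrightarrow> 0 < \<theta> v"
begin

lemma finite_A: "finite A"
  using A_sub finite_V finite_subset by blast

definition drawn :: "nat set \<Rightarrow> nat set \<Rightarrow> bool" where
  "drawn M X \<longleftrightarrow> M \<subseteq> A \<and> X \<subseteq> A \<and> {v \<in> A. live f \<theta> (S \<union> M) v} \<subseteq> X \<and> admissible S \<theta> M"

text \<open>Live elements are always undrawn: a drawn element either entered \<open>M\<close>, where
  its gain is 0 while \<open>\<theta>\<close> is positive, or failed the test, and gains never
  grow.\<close>

lemma drawn_step:
  assumes "drawn M X" "e \<in> X"
  shows "drawn (if live f \<theta> (S \<union> M) e then insert e M else M) (X - {e})"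
proof (cases "live f \<theta> (S \<union> M) e")
  case True
  have "\<not> live f \<theta> (S \<union> insert e M) e"
    using assms A_sub \<theta>_pos by (intro not_live_member) (auto simp: drawn_def)
  moreover have "live f \<theta> (S \<union> M) v" if "v \<in> A" "live f \<theta> (S \<union> insert e M) v" for v
    using that(2) by (rule live_antimono) (use assms that A_sub S_sub in \<open>auto simp: drawn_def\<close>)
  moreover have "admissible S \<theta> (insert e M)"
    using assms A_sub S_sub True by (intro admissible_insert) (auto simp: drawn_def)
  ultimately show ?thesis using assms True by (auto simp: drawn_def)
next
  case False
  then show ?thesis using assms by (auto simp: drawn_def)
qed

lemma runs_draw:
  "drawn M X \<Longrightarrow> n \<le> card X \<Longrightarrow>
   runs f (draw S \<theta> n M X) (\<lambda>q (M', X'). q = 2 * n \<and> drawn M' X' \<and> M \<subseteq> M' \<and> card X' + n = card X)"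
proof (induction n arbitrary: M X)
  case 0
  then show ?case by simp
next
  case (Suc n)
  have fin: "finite X" using Suc.prems finite_A finite_subset by (auto simp: drawn_def)
  have ne: "X \<noteq> {}" using Suc.prems by auto
  show ?case
    unfolding draw.simps runs_Samp runs_bind runs_query_all set_pmf_of_set[OF ne fin]
  proof
    fix e assume e: "e \<in> X"
    let ?M = "if live f \<theta> (S \<union> M) e then insert e M else M"
    have c: "card (X - {e}) = card X - 1" "card X > 0" using e fin by (auto simp: card_gt_0_iff)
    have "runs f (draw S \<theta> n ?M (X - {e})) (\<lambda>q (M', X').
        q = 2 * n \<and> drawn M' X' \<and> ?M \<subseteq> M' \<and> card X' + n = card (X - {e}))"
      using Suc.prems c by (intro Suc.IH drawn_step e) auto
    then have "runs f (draw S \<theta> n ?M (X - {e})) (\<lambda>q (M', X').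
        2 + q = 2 * Suc n \<and> drawn M' X' \<and> M \<subseteq> M' \<and> card X' + Suc n = card X)"
      by (rule runs_mono) (use c in \<open>auto split: if_splits\<close>)
    then show "runs f (draw S \<theta> n (if live (answers f (probe (S \<union> M) {e})) \<theta> (S \<union> M) e
          then insert e M else M) (X - {e})) (\<lambda>m a. case a of (M', X') \<Rightarrow>
        length (probe (S \<union> M) {e}) + m = 2 * Suc n \<and> drawn M' X' \<and> M \<subseteq> M' \<and>
        card X' + Suc n = card X)"
      by simp
  qed
qed

lemma lively_antimono:
  assumes "lively f \<theta> (S \<union> M') A" "M \<subseteq> M'" "M' \<subseteq> A"
  shows "lively f \<theta> (S \<union> M) A"
proof -
  have "{v \<in> A. live f \<theta> (S \<union> M') v} \<subseteq> {v \<in> A. live f \<theta> (S \<union> M) v}"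
    using live_antimono[of \<theta> "S \<union> M'" _ "S \<union> M"] assms A_sub S_sub by blast
  then have "card {v \<in> A. live f \<theta> (S \<union> M') v} \<le> card {v \<in> A. live f \<theta> (S \<union> M) v}"
    using finite_A by (intro card_mono) auto
  then show ?thesis using assms(1) by (simp add: lively_def)
qed

text \<open>The set \<open>P\<close> stands for the elements that will be updated before the next rebuilding, which are
  fixed beforehand as the adversary is oblivious. The term \<open>4 * d * n\<close> is a credit left by draws made
  while most of \<open>A\<close> was live; it pays for as many further draws (\<open>2 * d\<close> each), and for the draws
  already made.\<close>

lemma expects_draw:
  fixes P :: "nat set" and d :: real
  assumes P: "card (P \<inter> A) \<le> d * card A" and d: "0 \<le> d"
  defines "\<phi> \<equiv> \<lambda>M. real (card (M \<inter> P)) - 8 * d * card M"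
  shows "drawn M X \<Longrightarrow> card A + 2 * n \<le> 2 * card X \<Longrightarrow>
    expects f (draw S \<theta> n M X)
      (\<lambda>(M', X'). \<phi> M' + 4 * d * n * of_bool (lively f \<theta> (S \<union> M') A))
      (\<phi> M + 2 * d * n)"
proof (induction n arbitrary: M X)
  case 0
  then show ?case by simp
next
  case (Suc n)
  have fin: "finite X" using Suc.prems finite_A finite_subset by (auto simp: drawn_def)
  have ne: "X \<noteq> {}" using Suc.prems by auto
  have XA: "X \<subseteq> A" and MA: "M \<subseteq> A" using Suc.prems by (auto simp: drawn_def)
  have finM: "finite M" using MA finite_A finite_subset by blast
  define ext where "ext e = (if live f \<theta> (S \<union> M) e then insert e M else M)" for e
  let ?L = "{v \<in> A. live f \<theta> (S \<union> M) v}"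
  let ?l = "of_bool (lively f \<theta> (S \<union> M) A) :: real"
  have LX: "?L \<subseteq> X" using Suc.prems by (simp add: drawn_def)
  \<comment> \<open>The credit here is for \<open>Suc n\<close> draws, one more than in the
    induction hypothesis. If the final batch passes the test, so does the smaller present one, so
    the extra \<open>4 * d\<close> is covered by \<open>4 * d * ?l\<close>.\<close>
  have each: "expects f (draw S \<theta> n (ext e) (X - {e}))
      (\<lambda>(M', X'). \<phi> M' + 4 * d * Suc n * of_bool (lively f \<theta> (S \<union> M') A))
      (\<phi> (ext e) + 2 * d * n + 4 * d * ?l)" if e: "e \<in> X" for e
  proof -
    have dr: "drawn (ext e) (X - {e})"
      unfolding ext_def using Suc.prems e by (intro drawn_step)
    have cX: "card (X - {e}) = card X - 1" "card X > 0"
      using e fin by (auto simp: card_gt_0_iff)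
    have IH: "expects f (draw S \<theta> n (ext e) (X - {e}))
      (\<lambda>(M', X'). \<phi> M' + 4 * d * n * of_bool (lively f \<theta> (S \<union> M') A)) (\<phi> (ext e) + 2 * d * n)"
      using Suc.prems cX dr by (intro Suc.IH) auto
    have "runs f (draw S \<theta> n (ext e) (X - {e})) (\<lambda>q (M', X').
        q = 2 * n \<and> drawn M' X' \<and> ext e \<subseteq> M' \<and> card X' + n = card (X - {e}))"
      using Suc.prems cX dr by (intro runs_draw) auto
    then have "runs f (draw S \<theta> n (ext e) (X - {e})) (\<lambda>_ (M', X').
        lively f \<theta> (S \<union> M') A \<longrightarrow> lively f \<theta> (S \<union> M) A)"
    proof (rule runs_mono, clarify)
      fix M' X' assume "drawn M' X'" "ext e \<subseteq> M'" "lively f \<theta> (S \<union> M') A"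
      then show "lively f \<theta> (S \<union> M) A"
        by (intro lively_antimono[of M' M]) (auto simp: ext_def drawn_def split: if_splits)
    qed
    then have imp: "\<And>M' X'. (M', X') \<in> set_pmf (result f (draw S \<theta> n (ext e) (X - {e}))) \<Longrightarrow>
        lively f \<theta> (S \<union> M') A \<Longrightarrow> lively f \<theta> (S \<union> M) A"
      by (auto simp: runs_result)
    let ?p = "result f (draw S \<theta> n (ext e) (X - {e}))"
    have f: "finite (set_pmf ?p)" using IH by (simp add: expects_def)
    have "measure_pmf.expectation ?p
        (\<lambda>(M', X'). \<phi> M' + 4 * d * Suc n * of_bool (lively f \<theta> (S \<union> M') A))
      \<le> measure_pmf.expectation ?p
        (\<lambda>r. (\<lambda>(M', X'). \<phi> M' + 4 * d * n * of_bool (lively f \<theta> (S \<union> M') A)) r + 4 * d * ?l)"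
    proof (intro integral_mono_AE integrable_measure_pmf_finite f, unfold AE_measure_pmf_iff, clarify)
      fix M' X' assume "(M', X') \<in> set_pmf ?p"
      from imp[OF this] show "\<phi> M' + 4 * d * Suc n * of_bool (lively f \<theta> (S \<union> M') A)
          \<le> \<phi> M' + 4 * d * n * of_bool (lively f \<theta> (S \<union> M') A) + 4 * d * ?l"
        using d by (auto simp: algebra_simps)
    qed
    also have "\<dots> = measure_pmf.expectation ?p
        (\<lambda>(M', X'). \<phi> M' + 4 * d * n * of_bool (lively f \<theta> (S \<union> M') A)) + 4 * d * ?l"
      by (subst Bochner_Integration.integral_add)
        (auto intro!: integrable_measure_pmf_finite f)
    finally show ?thesis using IH by (simp add: expects_def)
  qed
  have step: "\<phi> (ext e) \<le> \<phi> M + of_bool (e \<in> P \<inter> X) - 8 * d * of_bool (e \<in> ?L)" if "e \<in> X" for e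
  proof (cases "live f \<theta> (S \<union> M) e")
    case True
    have "e \<notin> M"
      using True not_live_member[of e "S \<union> M" \<theta>] \<theta>_pos[of e] that XA A_sub by auto
    moreover have "card (insert e M \<inter> P) \<le> card (M \<inter> P) + of_bool (e \<in> P)"
      using finM by (auto simp: Int_insert_left card_insert_if)
    ultimately show ?thesis
      using True that XA finM by (auto simp: \<phi>_def ext_def algebra_simps)
  next
    case False
    then show ?thesis by (simp add: ext_def)
  qed
  have "(\<Sum>e\<in>X. \<phi> (ext e) + 2 * d * n + 4 * d * ?l)
      \<le> (\<Sum>e\<in>X. \<phi> M + of_bool (e \<in> P \<inter> X) - 8 * d * of_bool (e \<in> ?L) + 2 * d * n + 4 * d * ?l)"
    using step by (intro sum_mono) force
  also have "\<dots> = (\<phi> M + 2 * d * n + 4 * d * ?l) * card X + card (P \<inter> X) - 8 * d * card ?L"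
  proof -
    have "(\<Sum>e\<in>X. of_bool (e \<in> P \<inter> X) :: real) = card (P \<inter> X)"
      using fin by (simp add: of_bool_def sum.If_cases Int_absorb1 Int_commute)
    moreover have "(\<Sum>e\<in>X. of_bool (e \<in> ?L) :: real) = card ?L"
      using fin LX by (simp add: of_bool_def sum.If_cases Int_absorb1 del: mem_Collect_eq)
    ultimately show ?thesis
      by (simp add: sum.distrib sum_subtractf sum_distrib_left[symmetric] algebra_simps
          del: mem_Collect_eq Int_iff)
  qed
  \<comment> \<open>At least half of \<open>A\<close> is undrawn, so a draw hits \<open>P\<close>
    with probability at most \<open>2 * d\<close>. If most of \<open>A\<close> is live, so is at
    least half of \<open>X\<close>; the \<open>8 * d\<close> earned per accepted element then
    averages to at least \<open>4 * d\<close>, the credit for this draw.\<close>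
  also have "\<dots> \<le> (\<phi> M + 2 * d * Suc n) * card X"
  proof -
    have "card (P \<inter> X) \<le> card (P \<inter> A)"
      using XA finite_A by (intro card_mono) auto
    then have "card (P \<inter> X) \<le> d * card A" using P by linarith
    also have "\<dots> \<le> d * (2 * card X)"
      using Suc.prems d by (intro mult_left_mono) auto
    finally have 1: "card (P \<inter> X) \<le> 2 * d * card X" by simp
    have 2: "4 * d * ?l * card X \<le> 8 * d * card ?L"
    proof (cases "lively f \<theta> (S \<union> M) A")
      case True
      have "card X \<le> card A" using XA finite_A by (intro card_mono) auto
      then have "real (card X) \<le> 2 * real (card ?L)"
        using True by (simp add: lively_def)
      then have "4 * d * real (card X) \<le> 4 * d * (2 * real (card ?L))"
        using d by (intro mult_left_mono) auto
      then show ?thesis using True by (simp add: algebra_simps)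
    next
      case False
      then show ?thesis using d by simp
    qed
    show ?thesis using 1 2 by (simp add: algebra_simps)
  qed
  finally have sum: "(\<Sum>e\<in>X. \<phi> (ext e) + 2 * d * n + 4 * d * ?l)
      \<le> (\<phi> M + 2 * d * Suc n) * card X" .
  show ?case
    unfolding draw.simps
    by (rule expects_Samp_uniform[OF fin ne _ sum])
      (use each in \<open>auto simp: ext_def\<close>)
qed

text \<open>When a round begins, less than a quarter of \<open>A\<close> has been drawn, so doubling
  the draws leaves at least half of \<open>A\<close>, as \<open>expects_draw\<close>
  demands.\<close>

lemma lively_card:
  assumes "drawn M X" "lively f \<theta> (S \<union> M) A"
  shows "3 * card A < 4 * card X"
proof -
  have "card {v \<in> A. live f \<theta> (S \<union> M) v} \<le> card X"
    using assms(1) finite_A finite_subset by (intro card_mono) (auto simp: drawn_def)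
  then show ?thesis using assms(2) by (simp add: lively_def)
qed

text \<open>The fuel \<open>K\<close> cannot run out during a successful test, as \<open>j\<close>
  doubles in each round but never exceeds \<open>card A\<close>. A round costs
  \<open>card A + 1\<close> queries for the test and \<open>2 * j\<close> for the draws, with
  \<open>j\<close> below a quarter of \<open>card A\<close>.\<close>

lemma runs_extend:
  "drawn M X \<Longrightarrow> card X + j = card A \<Longrightarrow> card A < 2 ^ K * j \<Longrightarrow>
   runs f (extend S \<theta> A K j M X)
     (\<lambda>q M'. q \<le> K * (2 * card A + 1) \<and> M' \<subseteq> A \<and> admissible S \<theta> M' \<and> \<not> lively f \<theta> (S \<union> M') A)"
proof (induction K arbitrary: j M X)
  case 0
  then show ?case by simp
next
  case (Suc K)
  show ?case
  proof (cases "lively f \<theta> (S \<union> M) A")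
    case False
    then show ?thesis using Suc.prems finite_A by (auto simp: drawn_def)
  next
    case True
    have X: "3 * card A < 4 * card X" using lively_card True Suc.prems by blast
    have "runs f (draw S \<theta> j M X)
        (\<lambda>q (M', X'). q = 2 * j \<and> drawn M' X' \<and> M \<subseteq> M' \<and> card X' + j = card X)"
      using Suc.prems X by (intro runs_draw) auto
    then have "runs f (draw S \<theta> j M X)
        (\<lambda>q (M', X'). q = 2 * j \<and> runs f (extend S \<theta> A K (2 * j) M' X')
     (\<lambda>q M'. q \<le> K * (2 * card A + 1) \<and> M' \<subseteq> A \<and> admissible S \<theta> M' \<and> \<not> lively f \<theta> (S \<union> M') A))"
    proof (rule runs_mono, clarify)
      fix M' X' assume "drawn M' X'" "card X' + j = card X"
      then show "2 * j = 2 * j \<and> runs f (extend S \<theta> A K (2 * j) M' X') (\<lambda>q M'. q \<le> K * (2 * card A + 1) \<and>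
          M' \<subseteq> A \<and> admissible S \<theta> M' \<and> \<not> lively f \<theta> (S \<union> M') A)"
        using Suc.prems by (intro conjI refl Suc.IH) (auto simp: algebra_simps)
    qed
    then have "runs f (draw S \<theta> j M X)
        (\<lambda>q (M', X'). runs f (extend S \<theta> A K (2 * j) M' X')
     (\<lambda>q' M'. Suc (card A + (q + q')) \<le> Suc K * (2 * card A + 1) \<and> M' \<subseteq> A \<and> admissible S \<theta> M' \<and> \<not> lively f \<theta> (S \<union> M') A))"
      by (rule runs_mono) (use X Suc.prems in \<open>auto elim!: runs_mono\<close>)
    then show ?thesis
      using True finite_A by (simp add: case_prod_unfold)
  qed
qed

text \<open>A round of \<open>j\<close> draws may raise \<phi> by \<open>2 * d * j\<close>. It
  leaves a reserve of \<open>4 * d * j = 2 * d * (2 * j)\<close> whenever the next test succeeds,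
  which is just what the next round may add.\<close>

lemma expects_extend:
  fixes P :: "nat set" and d :: real
  assumes P: "card (P \<inter> A) \<le> d * card A" and d: "0 \<le> d"
  defines "\<phi> \<equiv> \<lambda>M. real (card (M \<inter> P)) - 8 * d * card M"
  shows "drawn M X \<Longrightarrow> card X + j = card A \<Longrightarrow>
    expects f (extend S \<theta> A K j M X) \<phi> (\<phi> M + 2 * d * j * of_bool (lively f \<theta> (S \<union> M) A))"
proof (induction K arbitrary: j M X)
  case 0
  then show ?case using d by simp
next
  case (Suc K)
  show ?case
  proof (cases "lively f \<theta> (S \<union> M) A")
    case False
    then show ?thesis using finite_A by simp
  next
    case True
    have X: "3 * card A < 4 * card X" using lively_card True Suc.prems by blast
    have dr: "runs f (draw S \<theta> j M X)
        (\<lambda>q (M', X'). q = 2 * j \<and> drawn M' X' \<and> M \<subseteq> M' \<and> card X' + j = card X)"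
      using Suc.prems X by (intro runs_draw) auto
    have e: "expects f (draw S \<theta> j M X)
      (\<lambda>(M', X'). \<phi> M' + 4 * d * j * of_bool (lively f \<theta> (S \<union> M') A))
      (\<phi> M + 2 * d * j)"
      unfolding \<phi>_def using Suc.prems X by (intro expects_draw P d) auto
    have "expects f (bind_comp (draw S \<theta> j M X) (\<lambda>(M', X'). extend S \<theta> A K (2 * j) M' X')) \<phi>
      (\<phi> M + 2 * d * j)"
    proof (rule expects_bind[OF e], rule runs_mono[OF dr], clarify)
      fix M' X' assume *: "drawn M' X'" "card X' + j = card X"
      have "expects f (extend S \<theta> A K (2 * j) M' X') \<phi>
         (\<phi> M' + 2 * d * (2 * j) * of_bool (lively f \<theta> (S \<union> M') A))"
        using Suc.IH[of M' X' "2 * j"] * Suc.prems by simp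
      then show "expects f (extend S \<theta> A K (2 * j) M' X') \<phi>
         (\<phi> M' + 4 * d * j * of_bool (lively f \<theta> (S \<union> M') A))"
        by (simp add: algebra_simps)
    qed
    then show ?thesis using True finite_A by simp
  qed
qed

lemma drawn_init: "drawn {} A"
  by (auto simp: drawn_def)

lemma runs_stage:
  assumes "A \<noteq> {}" "card A < 2 ^ K"
  shows "runs f (stage S \<theta> A K)
    (\<lambda>q M. q \<le> K * (2 * card A + 1) + 2 \<and> M \<subseteq> A \<and> admissible S \<theta> M \<and> \<not> lively f \<theta> (S \<union> M) A)"
proof -
  have "card A > 0" using assms finite_A by (simp add: card_gt_0_iff)
  then have "runs f (draw S \<theta> 1 {} A)
      (\<lambda>q (M', X'). q = 2 * 1 \<and> drawn M' X' \<and> {} \<subseteq> M' \<and> card X' + 1 = card A)"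
    by (intro runs_draw drawn_init) auto
  then have "runs f (draw S \<theta> 1 {} A)
      (\<lambda>q (M', X'). runs f (extend S \<theta> A K 1 M' X')
         (\<lambda>q' M. q + q' \<le> K * (2 * card A + 1) + 2 \<and> M \<subseteq> A \<and> admissible S \<theta> M \<and> \<not> lively f \<theta> (S \<union> M) A))"
    by (rule runs_mono) (use assms in \<open>auto intro!: runs_mono[OF runs_extend]\<close>)
  then show ?thesis by (simp add: stage_def case_prod_unfold del: One_nat_def draw.simps)
qed

lemma expects_stage:
  fixes P :: "nat set" and d :: real
  assumes P: "card (P \<inter> A) \<le> d * card A" and d: "0 \<le> d"
    and A: "A \<noteq> {}" "\<And>v. v \<in> A \<Longrightarrow> live f \<theta> S v"
  shows "expects f (stage S \<theta> A K) (\<lambda>M. real (card (M \<inter> P)) - 8 * d * card M) 0"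
proof -
  define \<phi> where "\<phi> = (\<lambda>M. real (card (M \<inter> P)) - 8 * d * card M)"
  have "card A > 0" using A finite_A by (simp add: card_gt_0_iff)
  then have dr: "runs f (draw S \<theta> 1 {} A)
      (\<lambda>q (M', X'). q = 2 * 1 \<and> drawn M' X' \<and> {} \<subseteq> M' \<and> card X' + 1 = card A)"
    by (intro runs_draw drawn_init) auto
  \<comment> \<open>All of \<open>A\<close> is live, so the first draw is accepted. It earns
    \<open>8 * d\<close>, of which \<open>2 * d\<close> is reserved for the next round, and it hits
    \<open>P\<close> with probability at most \<open>d\<close>.\<close>
  have e: "expects f (draw S \<theta> 1 {} A)
     (\<lambda>(M, X). \<phi> M + 2 * d * of_bool (lively f \<theta> (S \<union> M) A)) 0"
    unfolding One_nat_def draw.simps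
  proof (rule expects_Samp_uniform[OF finite_A A(1)])
    fix e assume e: "e \<in> A"
    show "expects f (bind_comp (query_all (probe (S \<union> {}) {e}))
       (\<lambda>h. Ret (if live h \<theta> (S \<union> {}) e then insert e {} else {}, A - {e})))
       (\<lambda>(M, X). \<phi> M + 2 * d * of_bool (lively f \<theta> (S \<union> M) A)) (of_bool (e \<in> P) - 6 * d)"
      using A(2)[OF e] d by (simp add: \<phi>_def)
  next
    have "(\<Sum>e\<in>A. of_bool (e \<in> P) - 6 * d) = card (P \<inter> A) - 6 * d * card A"
      using finite_A by (simp add: sum_subtractf of_bool_def sum.If_cases Int_commute)
    also have "\<dots> \<le> d * card A - 6 * d * card A" using P by simp
    also have "\<dots> \<le> 0" using d by (simp add: mult_right_mono)
    finally show "(\<Sum>e\<in>A. of_bool (e \<in> P) - 6 * d) \<le> 0 * real (card A)" by simp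
  qed
  show ?thesis
    unfolding stage_def \<phi>_def[symmetric]
  proof (rule expects_bind[OF e], rule runs_mono[OF dr], clarify)
    fix M X assume "drawn M X" "card X + 1 = card A"
    then show "expects f (extend S \<theta> A K 1 M X) \<phi>
       (\<phi> M + 2 * d * of_bool (lively f \<theta> (S \<union> M) A))"
      using expects_extend[OF P d, of M X 1 K] by (simp add: \<phi>_def)
  qed
qed

end

section \<open>The hierarchy of batches\<close>

text \<open>Counting the thresholds \<open>a0 * 2 ^ i\<close> that the gain reaches yields its
  dyadic class, capped at \<open>B\<close>, without logarithms. Index 0 marks elements that are not
  live.\<close>

definition idx :: "(nat set \<Rightarrow> real) \<Rightarrow> (nat \<Rightarrow> real) \<Rightarrow> real \<Rightarrow> nat \<Rightarrow> nat set \<Rightarrow> nat \<Rightarrow> nat" where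
  "idx f \<theta> a0 B S v =
     (if live f \<theta> S v then card {i. i < B \<and> a0 * 2 ^ i \<le> f (insert v S) - f S} else 0)"

lemma idx_probe [simp]:
  "finite X \<Longrightarrow> v \<in> X \<Longrightarrow> idx (answers f (probe S X)) \<theta> a0 B S v = idx f \<theta> a0 B S v"
  by (simp add: idx_def)

datatype level =
  Level (cands: "nat set") (batch: "nat set") (scale: real) (touched: "nat set")

definition bucket :: "(nat set \<Rightarrow> real) \<Rightarrow> (nat \<Rightarrow> real) \<Rightarrow> real \<Rightarrow> nat \<Rightarrow> nat set \<Rightarrow> nat set \<Rightarrow> nat \<Rightarrow> nat set" where
  "bucket f \<theta> a0 B S R i = {v \<in> R. idx f \<theta> a0 B S v = Suc i}"

definition big_bucket :: "(nat set \<Rightarrow> real) \<Rightarrow> (nat \<Rightarrow> real) \<Rightarrow> real \<Rightarrow> nat \<Rightarrow> nat set \<Rightarrow> nat set \<Rightarrow> nat" where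
  "big_bucket f \<theta> a0 B S R = (SOME i. i < B \<and> card R \<le> B * card (bucket f \<theta> a0 B S R i))"

text \<open>The threshold \<open>max a (\<theta> v)\<close> preserves both bounds: density for the
  cost, and the common scale \<open>a\<close> for comparing losses with gains. The next level starts
  from \<open>R'\<close> because an element that is not live never becomes live over a larger
  set.\<close>

primrec build :: "(nat \<Rightarrow> real) \<Rightarrow> real \<Rightarrow> nat \<Rightarrow> nat \<Rightarrow> nat set \<Rightarrow> nat set \<Rightarrow> level list comp" where
  "build \<theta> a0 B 0 S R = Ret [Level {} {} 0 {}]"
| "build \<theta> a0 B (Suc n) S R =
     bind_comp (query_all (probe S R)) (\<lambda>h.
       let R' = {v \<in> R. live h \<theta> S v}; i = big_bucket h \<theta> a0 B S R'; a = a0 * 2 ^ i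
       in if R' = {} then Ret [Level {} {} 0 {}]
          else bind_comp (stage S (\<lambda>v. max a (\<theta> v)) (bucket h \<theta> a0 B S R' i) B) (\<lambda>M.
            bind_comp (build \<theta> a0 B n (S \<union> M) R') (\<lambda>ls. Ret (Level R' M a {} # ls))))"

text \<open>A level is rebuilt once too many elements were updated since it was built, no matter which.
  Whether it is rebuilt thus depends on \<open>cands\<close> but not on the random choice of \<open>batch\<close>. The last
  level has no candidates, so it is rebuilt at every update, which takes care of insertions.\<close>

primrec refresh :: "(nat \<Rightarrow> real) \<Rightarrow> real \<Rightarrow> nat \<Rightarrow> real \<Rightarrow> nat \<Rightarrow> nat set \<Rightarrow>
    nat \<Rightarrow> nat set \<Rightarrow> level list \<Rightarrow> level list comp" where
  "refresh \<theta> a0 B \<delta> x W n S [] = Ret []"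
| "refresh \<theta> a0 B \<delta> x W n S (l # ls) =
     (let P = insert x (touched l)
      in if real (card P) \<le> \<delta> * real (card (cands l))
         then bind_comp (refresh \<theta> a0 B \<delta> x W (n - 1) (S \<union> batch l) ls)
                (\<lambda>ls'. Ret (Level (cands l) (batch l) (scale l) P # ls'))
         else build \<theta> a0 B n S ((cands l \<union> P) \<inter> W))"

definition total :: "level list \<Rightarrow> nat set" where
  "total ls = (\<Union>l\<in>set ls. batch l)"

lemma total_simps [simp]: "total [] = {}" "total (l # ls) = batch l \<union> total ls"
  by (simp_all add: total_def)

definition spent :: "level list \<Rightarrow> real" where
  "spent ls = (\<Sum>l\<leftarrow>ls. real (card (touched l)))"

lemma spent_simps [simp]: "spent [] = 0" "spent (l # ls) = card (touched l) + spent ls"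
  by (simp_all add: spent_def)

lemma spent_nonneg: "0 \<le> spent ls"
  by (induction ls) simp_all

text \<open>\<open>U\<close> holds the elements for which this threshold is responsible.
  \<open>gain_cap\<close> makes \<open>B\<close> classes suffice on it; \<open>\<delta>_le\<close>
  keeps the tolerated updates within half of the potential drop of a level; by
  \<open>N_large\<close>, a potential of at most \<open>B * card V\<close> is used up in
  \<open>N\<close> levels.\<close>

locale leveled = submodular +
  fixes \<theta> :: "nat \<Rightarrow> real" and a0 :: real and B N :: nat and \<delta> :: real and U :: "nat set"
  assumes U_sub: "U \<subseteq> V"
    and a0_pos: "0 < a0" and a0_le: "\<And>v. v \<in> V \<Longrightarrow> a0 \<le> \<theta> v"
    and gain_cap: "\<And>v. v \<in> U \<Longrightarrow> f {v} - f {} < a0 * 2 ^ B"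
    and B_pos: "0 < B" and card_V: "card V < 2 ^ B"
    and \<delta>_pos: "0 < \<delta>" and \<delta>_le: "\<delta> * (8 * B ^ 3) \<le> 1"
    and N_large: "B * card V < (1 + 1 / (8 * B ^ 2) :: real) ^ N"
begin

lemma \<theta>_pos: "v \<in> V \<Longrightarrow> 0 < \<theta> v"
  using a0_pos a0_le by fastforce

lemma finite_U: "finite U"
  using U_sub finite_V finite_subset by blast

lemma finite_below_U: "X \<subseteq> C \<Longrightarrow> C \<subseteq> U \<Longrightarrow> finite X"
  by (rule finite_subset[OF subset_trans finite_U])

section \<open>Dyadic classes of marginal gains\<close>

abbreviation index :: "nat set \<Rightarrow> nat \<Rightarrow> nat" where
  "index \<equiv> idx f \<theta> a0 B"

lemma index_le: "index S v \<le> B"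
proof -
  have "card {i. i < B \<and> a0 * 2 ^ i \<le> f (insert v S) - f S} \<le> card {..<B}"
    by (intro card_mono) auto
  then show ?thesis by (simp add: idx_def)
qed

lemma index_pos:
  assumes "live f \<theta> S v" "v \<in> V"
  shows "1 \<le> index S v"
proof -
  have "a0 \<le> f (insert v S) - f S" using assms a0_le[of v] by (simp add: live_def)
  then have "{0} \<subseteq> {i. i < B \<and> a0 * 2 ^ i \<le> f (insert v S) - f S}"
    using B_pos by auto
  from card_mono[OF _ this] show ?thesis using assms by (simp add: idx_def)
qed

lemma index_antimono:
  assumes "S \<subseteq> T" "T \<subseteq> V" "v \<in> V"
  shows "index T v \<le> index S v"
proof (cases "live f \<theta> T v")
  case True
  then have "live f \<theta> S v" by (rule live_antimono) (use assms in auto)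
  moreover have "card {i. i < B \<and> a0 * 2 ^ i \<le> f (insert v T) - f T}
      \<le> card {i. i < B \<and> a0 * 2 ^ i \<le> f (insert v S) - f S}"
    using gain_antimono[OF assms] by (intro card_mono) auto
  ultimately show ?thesis using True by (simp add: idx_def)
next
  case False
  then show ?thesis by (simp add: idx_def)
qed

text \<open>The thresholds reached form an initial segment, so their number determines them.\<close>

lemma index_iff:
  assumes "index S v = Suc i"
  shows "j < B \<and> a0 * 2 ^ j \<le> f (insert v S) - f S \<longleftrightarrow> j \<le> i"
proof -
  let ?D = "{i. i < B \<and> a0 * 2 ^ i \<le> f (insert v S) - f S}"
  have c: "card ?D = Suc i" using assms by (auto simp: idx_def split: if_splits)
  have "?D \<subseteq> {..<Suc i}"
  proof
    fix k assume k: "k \<in> ?D"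
    have "{..k} \<subseteq> ?D"
    proof
      fix j assume "j \<in> {..k}"
      then have "a0 * 2 ^ j \<le> a0 * 2 ^ k" using a0_pos by simp
      then show "j \<in> ?D" using k \<open>j \<in> {..k}\<close> by auto
    qed
    from card_mono[OF _ this] show "k \<in> {..<Suc i}" using c by simp
  qed
  then have "?D = {..<Suc i}" using c by (intro card_subset_eq) auto
  then have "j \<in> ?D \<longleftrightarrow> j \<in> {..<Suc i}" by blast
  then show ?thesis by auto
qed

lemma index_Suc_bounds:
  assumes "index S v = Suc i" "S \<subseteq> V" "v \<in> U"
  shows "live f \<theta> S v" "i < B" "a0 * 2 ^ i \<le> f (insert v S) - f S"
    "f (insert v S) - f S \<le> 2 * (a0 * 2 ^ i)"
proof -
  show "live f \<theta> S v" using assms(1) by (auto simp: idx_def split: if_splits)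
  show i: "i < B" "a0 * 2 ^ i \<le> f (insert v S) - f S"
    using index_iff[OF assms(1), of i] by auto
  show "f (insert v S) - f S \<le> 2 * (a0 * 2 ^ i)"
  proof (cases "Suc i < B")
    case True
    then show ?thesis using index_iff[OF assms(1), of "Suc i"] by auto
  next
    case False
    \<comment> \<open>The top class has no next threshold; the cap on singleton gains replaces
      it.\<close>
    then have "B = Suc i" using i by simp
    then show ?thesis
      using gain_cap[OF assms(3)] gain_antimono[of "{}" S v] assms U_sub by auto
  qed
qed

lemma index_le_if_not_live:
  assumes "\<not> live f (\<lambda>v. max (a0 * 2 ^ i) (\<theta> v)) S v"
  shows "index S v \<le> i"
proof (cases "live f \<theta> S v")
  case True
  then have g: "f (insert v S) - f S < a0 * 2 ^ i" using assms by (auto simp: live_def)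
  have "{j. j < B \<and> a0 * 2 ^ j \<le> f (insert v S) - f S} \<subseteq> {..<i}"
  proof clarsimp
    fix j assume "a0 * 2 ^ j \<le> f (insert v S) - f S"
    then have "a0 * 2 ^ j < a0 * 2 ^ i" using g by linarith
    then show "j < i" using a0_pos by simp
  qed
  from card_mono[OF _ this] show ?thesis using True by (simp add: idx_def)
next
  case False
  then show ?thesis by (simp add: idx_def)
qed

text \<open>Pigeonhole over the \<open>B\<close> classes, which cover \<open>R\<close> because live
  elements have positive index.\<close>

lemma exists_big_bucket:
  assumes "finite R" "R \<subseteq> V" "\<And>v. v \<in> R \<Longrightarrow> live f \<theta> S v"
  shows "big_bucket f \<theta> a0 B S R < B \<and>
    card R \<le> B * card (bucket f \<theta> a0 B S R (big_bucket f \<theta> a0 B S R))"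
proof -
  have "\<exists>i<B. card R \<le> B * card (bucket f \<theta> a0 B S R i)"
  proof (rule ccontr)
    assume *: "\<not> ?thesis"
    have "R \<subseteq> (\<Union>i<B. bucket f \<theta> a0 B S R i)"
    proof
      fix v assume v: "v \<in> R"
      have "1 \<le> index S v" "index S v \<le> B" using assms v index_pos index_le by auto
      then have "v \<in> bucket f \<theta> a0 B S R (index S v - 1)" "index S v - 1 < B"
        using v by (auto simp: bucket_def)
      then show "v \<in> (\<Union>i<B. bucket f \<theta> a0 B S R i)" by blast
    qed
    then have "card R \<le> card (\<Union>i<B. bucket f \<theta> a0 B S R i)"
      using assms by (intro card_mono) (auto simp: bucket_def)
    also have "\<dots> \<le> (\<Sum>i<B. card (bucket f \<theta> a0 B S R i))"
      by (rule card_UN_le) simp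
    finally have "B * card R \<le> (\<Sum>i<B. B * card (bucket f \<theta> a0 B S R i))"
      by (simp add: sum_distrib_left[symmetric])
    also have "\<dots> < (\<Sum>i<B. card R)"
      using * B_pos by (intro sum_strict_mono) (auto simp: not_le)
    finally show False by simp
  qed
  then show ?thesis unfolding big_bucket_def by (rule someI_ex[OF exE]) blast
qed

text \<open>The potential of the candidates drops by a constant factor from a level to the next, even after
  the few updates that a level tolerates. This bounds the number of levels.\<close>

definition pot :: "nat set \<Rightarrow> nat set \<Rightarrow> real" where
  "pot S X = (\<Sum>v\<in>X. real (index S v))"

lemma pot_mono: "X \<subseteq> Y \<Longrightarrow> finite Y \<Longrightarrow> pot S X \<le> pot S Y"
  unfolding pot_def by (intro sum_mono2) auto

lemma pot_le: "pot S X \<le> B * card X"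
proof -
  have "pot S X \<le> (\<Sum>v\<in>X. real B)"
    unfolding pot_def using index_le by (intro sum_mono) simp
  then show ?thesis by (simp add: mult.commute)
qed

lemma card_le_pot:
  assumes "\<And>v. v \<in> X \<Longrightarrow> live f \<theta> S v" "X \<subseteq> V"
  shows "card X \<le> pot S X"
proof -
  have "(\<Sum>v\<in>X. 1) \<le> pot S X"
    unfolding pot_def using index_pos assms by (intro sum_mono) fastforce
  then show ?thesis by simp
qed

lemma pot_union: "finite X \<Longrightarrow> finite Y \<Longrightarrow> pot S (X \<union> Y) \<le> pot S X + pot S Y"
  unfolding pot_def by (subst sum.union_inter[symmetric]) (auto intro!: sum_nonneg)

text \<open>At least a quarter of \<open>A\<close> falls by a class, so the potential loses
  \<open>card A / 4\<close>; by the choice of the class, \<open>card A\<close> is at least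
  \<open>pot S R / B ^ 2\<close>. The factor \<open>1 - 1 / (4 * B ^ 2)\<close> is stated without
  division.\<close>

lemma pot_drop:
  assumes R: "R \<subseteq> U" "\<And>v. v \<in> R \<Longrightarrow> live f \<theta> S v" and S: "S \<subseteq> V"
    and A: "A = bucket f \<theta> a0 B S R i" and big: "card R \<le> B * card A"
    and M: "M \<subseteq> A" and dull: "\<not> lively f (\<lambda>v. max (a0 * 2 ^ i) (\<theta> v)) (S \<union> M) A"
  shows "4 * real B ^ 2 * pot (S \<union> M) R \<le> (4 * real B ^ 2 - 1) * pot S R"
proof -
  let ?\<theta> = "\<lambda>v. max (a0 * 2 ^ i) (\<theta> v)"
  let ?L = "{v \<in> A. live f ?\<theta> (S \<union> M) v}" and ?D = "{v \<in> A. \<not> live f ?\<theta> (S \<union> M) v}"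
  have finR: "finite R" using R finite_U finite_subset by blast
  have AR: "A \<subseteq> R" using A by (auto simp: bucket_def)
  have finA: "finite A" using AR finR finite_subset by blast
  have "card A = card ?L + card ?D"
    using finA by (subst card_Un_disjoint[symmetric]) (auto intro!: arg_cong[where f = card])
  then have D: "card A \<le> 4 * card ?D" using dull by (simp add: lively_def)
  have "pot (S \<union> M) R \<le> (\<Sum>v\<in>R. real (index S v) - of_bool (v \<in> ?D))"
    unfolding pot_def
  proof (rule sum_mono)
    fix v assume v: "v \<in> R"
    show "real (index (S \<union> M) v) \<le> real (index S v) - of_bool (v \<in> ?D)"
    proof (cases "v \<in> ?D")
      case True
      then have "index (S \<union> M) v \<le> i" using index_le_if_not_live by blast
      moreover have "index S v = Suc i" using True A by (auto simp: bucket_def)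
      ultimately show ?thesis using True by simp
    next
      case False
      have "index (S \<union> M) v \<le> index S v"
        using v R U_sub S M AR by (intro index_antimono) auto
      moreover have "of_bool (v \<in> ?D) = (0 :: real)" using False by (simp only: of_bool_eq)
      ultimately show ?thesis by linarith
    qed
  qed
  also have "\<dots> = pot S R - card ?D"
  proof -
    have "R \<inter> ?D = ?D" using AR by auto
    then have "(\<Sum>v\<in>R. of_bool (v \<in> ?D)) = real (card ?D)"
      using finR by (simp add: of_bool_def sum.If_cases del: mem_Collect_eq)
    then show ?thesis by (simp add: sum_subtractf pot_def del: mem_Collect_eq)
  qed
  finally have "pot (S \<union> M) R \<le> pot S R - card A / 4" using D by simp
  moreover have "pot S R \<le> B ^ 2 * card A"
  proof -
    have "pot S R \<le> B * card R" by (rule pot_le)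
    also have "\<dots> \<le> B * (B * card A)" using big by (simp flip: of_nat_mult)
    finally show ?thesis by (simp add: power2_eq_square)
  qed
  moreover have "4 * real B ^ 2 * pot (S \<union> M) R \<le> 4 * real B ^ 2 * (pot S R - card A / 4)"
    using calculation(1) by (intro mult_left_mono) auto
  ultimately show ?thesis by (simp add: algebra_simps)
qed

section \<open>The invariant of the levels and their number\<close>

abbreviation Q :: real where "Q \<equiv> 1 + 1 / (8 * real B ^ 2)"

text \<open>\<open>S\<close> is the union of the batches above, deleted elements included, so a
  deletion does not disturb the gains measured at later levels. \<open>C\<close> confines the list
  to the candidates and touched elements of the level above, and \<open>pot S C < Q ^ n\<close> says
  that \<open>n\<close> more levels suffice.\<close>

primrec coherent :: "nat set \<Rightarrow> nat \<Rightarrow> nat set \<Rightarrow> nat set \<Rightarrow> level list \<Rightarrow> bool" where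
  "coherent W n S C [] = False"
| "coherent W n S C (l # ls) \<longleftrightarrow>
     cands l \<union> touched l \<subseteq> C \<and> card (touched l) \<le> \<delta> * card (cands l) \<and>
     {v \<in> U \<inter> W. live f \<theta> S v} \<subseteq> cands l \<union> touched l \<and>
     (\<forall>v\<in>cands l. live f \<theta> S v) \<and> pot S C < Q ^ n \<and>
     batch l \<subseteq> cands l \<and> batch l - touched l \<subseteq> W \<and>
     0 \<le> scale l \<and> admissible S (\<lambda>v. max (scale l) (\<theta> v)) (batch l) \<and>
     (\<forall>v\<in>batch l. f (insert v S) - f S \<le> 2 * scale l) \<and>
     (if cands l = {} then ls = []
      else 4 * real B ^ 2 * pot (S \<union> batch l) (cands l) \<le> (4 * real B ^ 2 - 1) * pot S (cands l) \<and>
        coherent W (n - 1) (S \<union> batch l) (cands l \<union> touched l) ls)"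

text \<open>The batch removes the fraction \<open>2 * x\<close> of the potential, for
  \<open>x = 1 / (8 * B ^ 2)\<close>. Tolerated updates put back at most \<open>x\<close>, each
  adding at most \<open>B\<close>, and \<open>(1 - x) * (1 + x) \<le> 1\<close> turns the rest into
  one power of \<open>Q\<close>. A single live candidate has potential at least 1, hence
  \<open>0 < n\<close>.\<close>

lemma next_pot:
  assumes "R \<subseteq> C" "C \<subseteq> U" "P \<subseteq> U" "R \<noteq> {}" "\<And>v. v \<in> R \<Longrightarrow> live f \<theta> S v"
    and P: "card P \<le> \<delta> * card R" and C: "pot S C < Q ^ n"
    and drop: "4 * real B ^ 2 * pot (S \<union> M) R \<le> (4 * real B ^ 2 - 1) * pot S R"
  shows "0 < n" "pot (S \<union> M) (R \<union> P) < Q ^ (n - 1)"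
proof -
  have fin: "finite R" "finite P" "finite C"
    using assms finite_U finite_subset by (metis subset_trans)+
  have RC: "pot S R \<le> pot S C" using assms(1) fin by (intro pot_mono)
  have cR: "card R \<le> pot S R" using assms U_sub by (intro card_le_pot) auto
  have "0 < card R" using assms fin by (simp add: card_gt_0_iff)
  then have "1 \<le> pot S R" using cR by linarith
  then show n: "0 < n" using RC C by (cases n) auto
  define x where "x = 1 / (8 * real B ^ 2)"
  have B1: "1 \<le> real B ^ 2" using B_pos by (simp add: one_le_power)
  then have "1 < 8 * real B ^ 2" by linarith
  then have x: "0 < x" "x < 1" using B_pos by (auto simp: x_def)
  have dx: "B * \<delta> \<le> x"
    using \<delta>_le B_pos by (simp add: x_def field_simps power3_eq_cube power2_eq_square)
  have "pot (S \<union> M) R \<le> (1 - 2 * x) * pot S R"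
  proof -
    have e: "2 * x * (4 * real B ^ 2) = 1" using B_pos by (simp add: x_def)
    have "4 * real B ^ 2 * ((1 - 2 * x) * pot S R) = (4 * real B ^ 2 - 2 * x * (4 * real B ^ 2)) * pot S R"
      by (simp add: algebra_simps)
    then have "4 * real B ^ 2 * pot (S \<union> M) R \<le> 4 * real B ^ 2 * ((1 - 2 * x) * pot S R)"
      using drop unfolding e by linarith
    then show ?thesis using B_pos by (simp only: mult_le_cancel_left_pos zero_less_power of_nat_0_less_iff
          zero_less_mult_iff zero_less_numeral simp_thms)
  qed
  moreover have "pot (S \<union> M) P \<le> x * pot S R"
  proof -
    have "pot (S \<union> M) P \<le> B * card P" by (rule pot_le)
    also have "\<dots> \<le> B * (\<delta> * card R)" using P by (simp add: mult_left_mono)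
    also have "\<dots> \<le> x * card R" using dx by (simp add: mult_right_mono flip: mult.assoc)
    also have "\<dots> \<le> x * pot S R" using cR x by (intro mult_left_mono) auto
    finally show ?thesis .
  qed
  ultimately have "pot (S \<union> M) (R \<union> P) \<le> (1 - x) * pot S R"
    using pot_union[OF fin(1,2), of "S \<union> M"] by (simp add: algebra_simps)
  also have "\<dots> < (1 - x) * Q ^ n"
    using x RC C by (intro mult_strict_left_mono) auto
  also have "\<dots> = (1 - x) * (1 + x) * Q ^ (n - 1)"
    using n by (cases n) (simp_all add: x_def)
  also have "\<dots> \<le> 1 * Q ^ (n - 1)"
    using x by (intro mult_right_mono) (auto simp: algebra_simps)
  finally show "pot (S \<union> M) (R \<union> P) < Q ^ (n - 1)" by simp
qed

lemma coherent_length: "coherent W n S C ls \<Longrightarrow> C \<subseteq> U \<Longrightarrow> length ls \<le> Suc n"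
proof (induction ls arbitrary: n S C)
  case Nil
  then show ?case by simp
next
  case (Cons l ls)
  show ?case
  proof (cases "cands l = {}")
    case True
    then show ?thesis using Cons.prems by simp
  next
    case False
    have "0 < n"
      by (rule next_pot(1)[of "cands l" C "touched l" S n "batch l"])
        (use Cons.prems False in auto)
    moreover have "length ls \<le> Suc (n - 1)"
      by (rule Cons.IH[of "n - 1" "S \<union> batch l" "cands l \<union> touched l"])
       (use Cons.prems False in auto)
    ultimately show ?thesis by simp
  qed
qed

lemma coherent_batch_sub: "coherent W n S C (l # ls) \<Longrightarrow> C \<subseteq> U \<Longrightarrow> batch l \<subseteq> V"
  using U_sub by (simp only: coherent.simps) blast

lemma coherent_Nil_level: "pot S C < Q ^ n \<Longrightarrow> {v \<in> U \<inter> W. live f \<theta> S v} = {} \<Longrightarrow>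
    coherent W n S C [Level {} {} 0 {}]"
  by simp

lemma build_cases:
  assumes "S \<subseteq> V" "R \<subseteq> U" "R' = {v \<in> R. live f \<theta> S v}" "R' \<noteq> {}"
    "i = big_bucket f \<theta> a0 B S R'" "A = bucket f \<theta> a0 B S R' i" "a = a0 * 2 ^ i"
  shows "finite R" "A \<noteq> {}" "A \<subseteq> R'" "card R' \<le> B * card A" "0 \<le> a"
    "batching f V S A (\<lambda>v. max a (\<theta> v))"
    "\<And>v. v \<in> A \<Longrightarrow> live f (\<lambda>v. max a (\<theta> v)) S v"
    "\<And>v. v \<in> A \<Longrightarrow> f (insert v S) - f S \<le> 2 * a"
    "card A < 2 ^ B"
proof -
  show fin: "finite R" using assms(2) finite_U finite_subset by blast
  have "i < B \<and> card R' \<le> B * card A"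
    unfolding assms(5,6) using assms fin U_sub by (intro exists_big_bucket) auto
  then show big: "card R' \<le> B * card A" by simp
  have "0 < card R'" using assms fin by (simp add: card_gt_0_iff)
  then show "A \<noteq> {}" using big by auto
  show AR: "A \<subseteq> R'" using assms(6) by (auto simp: bucket_def)
  show "0 \<le> a" using assms a0_pos by simp
  show "batching f V S A (\<lambda>v. max a (\<theta> v))"
    using assms AR U_sub \<theta>_pos by unfold_locales (auto simp: less_max_iff_disj)
  have b: "live f \<theta> S v \<and> a \<le> f (insert v S) - f S \<and> f (insert v S) - f S \<le> 2 * a" if "v \<in> A" for v
    using index_Suc_bounds[of S v i] that assms by (auto simp: bucket_def)
  then show "\<And>v. v \<in> A \<Longrightarrow> live f (\<lambda>v. max a (\<theta> v)) S v"
    "\<And>v. v \<in> A \<Longrightarrow> f (insert v S) - f S \<le> 2 * a"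
    by (auto simp: live_def)
  have "card A \<le> card V" using AR assms U_sub finite_V by (intro card_mono) auto
  then show "card A < 2 ^ B" using card_V by simp
qed

text \<open>The program computes with recorded answers. They agree with \<open>f\<close> on the
  probed sets, so both judgements can be stated with \<open>f\<close> alone.\<close>

lemma build_Suc:
  assumes "finite R"
  shows "runs f (build \<theta> a0 B (Suc n) S R) G \<longleftrightarrow>
     (let R' = {v \<in> R. live f \<theta> S v}; i = big_bucket f \<theta> a0 B S R'; a = a0 * 2 ^ i
      in runs f (if R' = {} then Ret [Level {} {} 0 {}]
         else bind_comp (stage S (\<lambda>v. max a (\<theta> v)) (bucket f \<theta> a0 B S R' i) B) (\<lambda>M.
            bind_comp (build \<theta> a0 B n (S \<union> M) R') (\<lambda>ls. Ret (Level R' M a {} # ls))))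
         (\<lambda>q. G (Suc (card R) + q)))" (is ?th1)
    and "expects f (build \<theta> a0 B (Suc n) S R) g b \<longleftrightarrow>
     (let R' = {v \<in> R. live f \<theta> S v}; i = big_bucket f \<theta> a0 B S R'; a = a0 * 2 ^ i
      in expects f (if R' = {} then Ret [Level {} {} 0 {}]
         else bind_comp (stage S (\<lambda>v. max a (\<theta> v)) (bucket f \<theta> a0 B S R' i) B) (\<lambda>M.
            bind_comp (build \<theta> a0 B n (S \<union> M) R') (\<lambda>ls. Ret (Level R' M a {} # ls)))) g b)" (is ?th2)
proof -
  let ?h = "answers f (probe S R)" and ?R = "{v \<in> R. live f \<theta> S v}"
  have 1: "{v \<in> R. live ?h \<theta> S v} = ?R" using assms by auto
  have 2: "bucket ?h \<theta> a0 B S ?R = bucket f \<theta> a0 B S ?R"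
    using assms by (auto simp: bucket_def fun_eq_iff)
  then have 3: "big_bucket ?h \<theta> a0 B S ?R = big_bucket f \<theta> a0 B S ?R"
    by (simp add: big_bucket_def)
  show ?th1 ?th2
    by (simp_all only: build.simps runs_bind[of f "query_all (probe S R)"] runs_query_all
        expects_query_all Let_def 1 2 3 length_probe[OF assms])
qed

lemma runs_build:
  "S \<subseteq> V \<Longrightarrow> {v \<in> U \<inter> W. live f \<theta> S v} \<subseteq> R \<Longrightarrow> R \<subseteq> C \<inter> W \<Longrightarrow> C \<subseteq> U \<Longrightarrow> pot S C < Q ^ n \<Longrightarrow>
   runs f (build \<theta> a0 B n S R)
     (\<lambda>q ls. q \<le> n * ((2 * B + 3) * (card R + 1)) \<and> coherent W n S C ls \<and> spent ls = 0)"
proof (induction n arbitrary: S R C)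
  case 0
  \<comment> \<open>At \<open>n = 0\<close> the potential is below 1, while each live element would
    contribute at least 1; so stopping with an empty level is right.\<close>
  have "{v \<in> U \<inter> W. live f \<theta> S v} = {}"
  proof (rule ccontr)
    let ?X = "{v \<in> U \<inter> W. live f \<theta> S v}"
    assume "?X \<noteq> {}"
    then have "0 < card ?X" using finite_U by (simp add: card_gt_0_iff)
    moreover have "card ?X \<le> pot S ?X" using U_sub by (intro card_le_pot) auto
    moreover have "pot S ?X \<le> pot S C"
      using 0 finite_U by (intro pot_mono) (auto intro: finite_subset)
    ultimately show False using 0 by simp
  qed
  then show ?case using 0 by simp
next
  case (Suc n)
  define R' where "R' = {v \<in> R. live f \<theta> S v}"
  define i where "i = big_bucket f \<theta> a0 B S R'"
  define A where "A = bucket f \<theta> a0 B S R' i"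
  define a where "a = a0 * 2 ^ i"
  have RU: "R \<subseteq> U" using Suc.prems by blast
  have finR: "finite R" using RU finite_U finite_subset by blast
  show ?case
  proof (cases "R' = {}")
    case True
    then have "{v \<in> U \<inter> W. live f \<theta> S v} = {}" using Suc.prems by (auto simp: R'_def)
    moreover have "Suc (card R) \<le> Suc n * ((2 * B + 3) * (card R + 1))"
    proof -
      have "1 * (1 * (card R + 1)) \<le> Suc n * ((2 * B + 3) * (card R + 1))"
        by (intro mult_le_mono) auto
      then show ?thesis by simp
    qed
    ultimately show ?thesis
      using True Suc.prems(5)
      by (simp add: build_Suc(1)[OF finR] R'_def[symmetric] Let_def del: build.simps power_Suc)
  next
    case False
    note bc = build_cases[OF Suc.prems(1) RU R'_def False i_def A_def a_def]
    interpret b: batching f V S A "\<lambda>v. max a (\<theta> v)" by (rule bc(6))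
    have R'U: "R' \<subseteq> U" using RU by (auto simp: R'_def)
    have cardR': "card R' \<le> card R" using finR by (auto simp: R'_def intro: card_mono)
    have cardA: "card A \<le> card R'" using bc(3) finR by (auto simp: R'_def intro!: card_mono)
    have "runs f (stage S (\<lambda>v. max a (\<theta> v)) A B) (\<lambda>q M.
        q \<le> B * (2 * card A + 1) + 2 \<and> M \<subseteq> A \<and> admissible S (\<lambda>v. max a (\<theta> v)) M \<and>
        \<not> lively f (\<lambda>v. max a (\<theta> v)) (S \<union> M) A)"
      using bc by (intro b.runs_stage) auto
    then have "runs f (stage S (\<lambda>v. max a (\<theta> v)) A B) (\<lambda>q M.
        runs f (build \<theta> a0 B n (S \<union> M) R') (\<lambda>q' ls.
          Suc (card R) + (q + q') \<le> Suc n * ((2 * B + 3) * (card R + 1)) \<and>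
          coherent W (Suc n) S C (Level R' M a {} # ls) \<and> spent (Level R' M a {} # ls) = 0))"
    proof (rule runs_mono, elim conjE)
      fix q M assume q: "q \<le> B * (2 * card A + 1) + 2" and M: "M \<subseteq> A"
        and adm: "admissible S (\<lambda>v. max a (\<theta> v)) M"
        and dull: "\<not> lively f (\<lambda>v. max a (\<theta> v)) (S \<union> M) A"
      have drop: "4 * real B ^ 2 * pot (S \<union> M) R' \<le> (4 * real B ^ 2 - 1) * pot S R'"
        by (rule pot_drop[OF R'U _ Suc.prems(1) A_def bc(4) M])
          (use dull in \<open>auto simp: a_def R'_def\<close>)
      have np: "pot (S \<union> M) (R' \<union> {}) < Q ^ (Suc n - 1)"
        by (rule next_pot(2)[where C = C, OF _ _ _ False _ _ Suc.prems(5) drop])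
          (use Suc.prems \<delta>_pos in \<open>auto simp: R'_def\<close>)
      have SM: "S \<union> M \<subseteq> V" using Suc.prems(1) M bc(3) R'U U_sub by blast
      have "{v \<in> U \<inter> W. live f \<theta> (S \<union> M) v} \<subseteq> {v \<in> U \<inter> W. live f \<theta> S v}"
        using live_antimono[of \<theta> "S \<union> M" _ S] SM U_sub by blast
      also have "\<dots> \<subseteq> R'" using Suc.prems(2) by (auto simp: R'_def)
      finally have "runs f (build \<theta> a0 B n (S \<union> M) R') (\<lambda>q ls.
          q \<le> n * ((2 * B + 3) * (card R' + 1)) \<and> coherent W n (S \<union> M) R' ls \<and> spent ls = 0)"
        using Suc.prems(3) np R'U by (intro Suc.IH SM) (auto simp: R'_def)
      then show "runs f (build \<theta> a0 B n (S \<union> M) R') (\<lambda>q' ls.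
          Suc (card R) + (q + q') \<le> Suc n * ((2 * B + 3) * (card R + 1)) \<and>
          coherent W (Suc n) S C (Level R' M a {} # ls) \<and> spent (Level R' M a {} # ls) = 0)"
      proof (rule runs_mono, elim conjE, intro conjI)
        fix q' ls assume *: "q' \<le> n * ((2 * B + 3) * (card R' + 1))"
          "coherent W n (S \<union> M) R' ls" "spent ls = 0"
        have "n * ((2 * B + 3) * (card R' + 1)) \<le> n * ((2 * B + 3) * (card R + 1))"
          using cardR' by simp
        then have "q' \<le> n * ((2 * B + 3) * (card R + 1))" using *(1) by (rule order_trans[rotated])
        moreover have "B * (2 * card A + 1) \<le> B * (2 * card R + 1)"
          using cardA cardR' by simp
        then have "q \<le> B * (2 * card R + 1) + 2" using q by linarith
        ultimately show "Suc (card R) + (q + q') \<le> Suc n * ((2 * B + 3) * (card R + 1))"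
          by (simp add: algebra_simps)
        have "{v \<in> U \<inter> W. live f \<theta> S v} \<subseteq> R'" using Suc.prems(2) by (auto simp: R'_def)
        moreover have "R' \<subseteq> C \<inter> W" using Suc.prems(3) by (auto simp: R'_def)
        moreover have "\<forall>v\<in>R'. live f \<theta> S v" by (auto simp: R'_def)
        ultimately show "coherent W (Suc n) S C (Level R' M a {} # ls)"
          using * drop False adm bc M \<delta>_pos Suc.prems(5) by auto
        show "spent (Level R' M a {} # ls) = 0" using * by simp
      qed
    qed
    then show ?thesis
      unfolding build_Suc(1)[OF finR] Let_def R'_def[symmetric] i_def[symmetric]
        A_def[symmetric] a_def[symmetric]
      by (simp only: False if_False runs_bind runs_Ret add_0_right)
  qed
qed

text \<open>This keeps the invariant of every threshold whose \<open>U\<close> does not contain the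
  updated element.\<close>

lemma coherent_irrelevant:
  "coherent W n S C ls \<Longrightarrow> C \<subseteq> U \<Longrightarrow> W' \<inter> U = W \<inter> U \<Longrightarrow> coherent W' n S C ls"
proof (induction ls arbitrary: n S C)
  case Nil
  then show ?case by simp
next
  case (Cons l ls)
  have "batch l \<subseteq> U" "batch l - touched l \<subseteq> W" using Cons.prems by auto
  then have "batch l - touched l \<subseteq> W'" using Cons.prems(3) by blast
  moreover have "U \<inter> W' = U \<inter> W" using Cons.prems(3) by blast
  moreover have "cands l \<noteq> {} \<Longrightarrow> coherent W' (n - 1) (S \<union> batch l) (cands l \<union> touched l) ls"
    using Cons.prems by (intro Cons.IH) auto
  ultimately show ?case using Cons.prems(1) by simp
qed

definition rate :: real where
  "rate = N * ((2 * B + 3) * (1 / \<delta> + 2))"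

text \<open>Amortization with the potential \<open>rate * spent\<close>. Each surviving level gains
  at most one touched element, a deposit of \<open>rate\<close>; a rebuild is paid by the deposits
  of the topmost rebuilt level. \<open>C'\<close> also contains \<open>x\<close>, which the level
  above now counts as touched.\<close>

lemma runs_refresh:
  assumes x: "x \<in> U" and W: "W' - {x} = W - {x}"
  shows "coherent W n S C ls \<Longrightarrow> S \<subseteq> V \<Longrightarrow> C \<subseteq> C' \<Longrightarrow> x \<in> C' \<Longrightarrow> C' \<subseteq> U \<Longrightarrow> pot S C' < Q ^ n \<Longrightarrow> n \<le> N \<Longrightarrow>
   runs f (refresh \<theta> a0 B \<delta> x W' n S ls)
     (\<lambda>q ls'. coherent W' n S C' ls' \<and> q + rate * spent ls' \<le> rate * (spent ls + length ls))"
proof (induction ls arbitrary: n S C C')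
  case Nil
  then show ?case by simp
next
  case (Cons l ls)
  define P where "P = insert x (touched l)"
  have PC: "P \<subseteq> C'" "cands l \<subseteq> C'" using Cons.prems by (auto simp: P_def)
  have fin: "finite P" "finite (cands l)" "finite (touched l)"
    using PC Cons.prems(5) finite_below_U by (auto simp: P_def)
  have cP: "card P \<le> Suc (card (touched l))" "1 \<le> card P"
    using fin by (auto simp: P_def card_insert_if Suc_le_eq card_gt_0_iff)
  have rate: "0 \<le> rate" using \<delta>_pos by (simp add: rate_def)
  have spent: "0 \<le> spent ls" by (rule spent_nonneg)
  have alive: "{v \<in> U \<inter> W'. live f \<theta> S v} \<subseteq> cands l \<union> P"
    using Cons.prems(1) W by (auto simp: P_def)
  show ?case
  proof (cases "card P \<le> \<delta> * card (cands l)")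
    case True
    then have ne: "cands l \<noteq> {}" using cP by auto
    have bU: "batch l \<subseteq> V" using coherent_batch_sub Cons.prems by blast
    have "pot (S \<union> batch l) (cands l \<union> P) < Q ^ (n - 1)"
      by (rule next_pot(2)[where C = C'])
        (use Cons.prems PC ne True in auto)
    then have "runs f (refresh \<theta> a0 B \<delta> x W' (n - 1) (S \<union> batch l) ls)
     (\<lambda>q ls'. coherent W' (n - 1) (S \<union> batch l) (cands l \<union> P) ls' \<and>
        q + rate * spent ls' \<le> rate * (spent ls + length ls))"
      using Cons.prems ne PC bU by (intro Cons.IH) (auto simp: P_def)
    then have "runs f (refresh \<theta> a0 B \<delta> x W' (n - 1) (S \<union> batch l) ls)
     (\<lambda>q ls'. coherent W' n S C' (Level (cands l) (batch l) (scale l) P # ls') \<and>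
        q + rate * spent (Level (cands l) (batch l) (scale l) P # ls')
          \<le> rate * (spent (l # ls) + length (l # ls)))"
    proof (rule runs_mono, elim conjE, intro conjI)
      fix q ls' assume i: "coherent W' (n - 1) (S \<union> batch l) (cands l \<union> P) ls'"
        and q: "q + rate * spent ls' \<le> rate * (spent ls + length ls)"
      have "batch l - P \<subseteq> W'" using Cons.prems(1) W by (auto simp: P_def)
      then show "coherent W' n S C' (Level (cands l) (batch l) (scale l) P # ls')"
        using Cons.prems(1,6) i True alive PC ne by simp
      have "rate * card P \<le> rate * Suc (card (touched l))"
        using cP rate by (intro mult_left_mono) auto
      then show "q + rate * spent (Level (cands l) (batch l) (scale l) P # ls')
          \<le> rate * (spent (l # ls) + length (l # ls))"
        using q by (simp add: algebra_simps)
    qed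
    then show ?thesis using True by (simp add: P_def[symmetric] del: coherent.simps spent_simps)
  next
    case False
    let ?R = "(cands l \<union> P) \<inter> W'"
    have bd: "runs f (build \<theta> a0 B n S ?R) (\<lambda>q ls'. q \<le> n * ((2 * B + 3) * (card ?R + 1)) \<and>
        coherent W' n S C' ls' \<and> spent ls' = 0)"
      using Cons.prems PC alive by (intro runs_build) auto
    \<comment> \<open>The tolerance is exceeded, so there are at most
      \<open>card P / \<delta>\<close> candidates. The 2 in \<open>1 / \<delta> + 2\<close> covers
      \<open>P\<close> itself and the additive 1, as \<open>card P\<close> is positive.\<close>
    have rl: "real (n * ((2 * B + 3) * (card ?R + 1))) \<le> rate * (spent (l # ls) + length (l # ls))"
    proof -
      have "card ?R \<le> card (cands l) + card P"
        by (meson card_Un_le card_mono fin finite_Un inf_le1 le_trans)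
      moreover have "card (cands l) \<le> card P / \<delta>"
        using False \<delta>_pos by (simp add: field_simps)
      ultimately have "real (card ?R + 1) \<le> (1 / \<delta> + 2) * card P"
        using cP by (simp add: algebra_simps)
      then have "real (n * ((2 * B + 3) * (card ?R + 1))) \<le> N * ((2 * B + 3) * ((1 / \<delta> + 2) * card P))"
        unfolding of_nat_mult using Cons.prems(7) \<delta>_pos by (intro mult_mono) auto
      also have "\<dots> = rate * card P" by (simp add: rate_def)
      also have "\<dots> \<le> rate * (spent (l # ls) + length (l # ls))"
        using cP spent rate by (intro mult_left_mono) auto
      finally show ?thesis .
    qed
    from bd have "runs f (build \<theta> a0 B n S ?R) (\<lambda>q ls'. coherent W' n S C' ls' \<and>
        q + rate * spent ls' \<le> rate * (spent (l # ls) + length (l # ls)))"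
    proof (rule runs_mono, elim conjE, intro conjI)
      fix q ls' assume q: "q \<le> n * ((2 * B + 3) * (card ?R + 1))" and "spent ls' = 0"
      then show "q + rate * spent ls' \<le> rate * (spent (l # ls) + length (l # ls))"
        using of_nat_mono[OF q, where 'a = real] rl by simp
    qed
    then show ?thesis using False by (simp add: P_def[symmetric] del: coherent.simps spent_simps)
  qed
qed

section \<open>The expected loss as a supermartingale\<close>

abbreviation \<eta> :: real where "\<eta> \<equiv> 16 * (\<delta> * B)"

text \<open>With \<open>F\<close> the set of elements updated between now and a fixed target time, \<open>surplus F\<close> counts
  exactly the levels that survive until then; it is a supermartingale.\<close>

primrec surplus :: "nat set \<Rightarrow> level list \<Rightarrow> real" where
  "surplus F [] = 0"
| "surplus F (l # ls) =
     (if card (touched l \<union> F) \<le> \<delta> * card (cands l)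
      then 2 * scale l * card (batch l \<inter> (touched l \<union> F)) - \<eta> * scale l * card (batch l) + surplus F ls
      else 0)"

text \<open>\<open>card F \<le> \<delta> * card R'\<close> is decided before the batch is drawn. If
  it holds, \<open>F\<close> meets the sampled class in at most the fraction
  \<open>\<delta> * B\<close>, since the class contains at least a \<open>B\<close>-th of the
  candidates; \<open>expects_stage\<close> with this fraction yields \<eta>. Otherwise the level and
  its successors contribute 0.\<close>

lemma expects_build:
  assumes F: "finite F"
  shows "S \<subseteq> V \<Longrightarrow> R \<subseteq> U \<Longrightarrow> expects f (build \<theta> a0 B n S R) (surplus F) 0"
proof (induction n arbitrary: S R)
  case 0
  then show ?case by simp
next
  case (Suc n)
  define R' where "R' = {v \<in> R. live f \<theta> S v}"
  define i where "i = big_bucket f \<theta> a0 B S R'"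
  define A where "A = bucket f \<theta> a0 B S R' i"
  define a where "a = a0 * 2 ^ i"
  have finR: "finite R" using Suc.prems finite_U finite_subset by blast
  show ?case
  proof (cases "R' = {}")
    case True
    then show ?thesis by (simp add: build_Suc(2)[OF finR] R'_def del: build.simps)
  next
    case False
    note bc = build_cases[OF Suc.prems(1,2) R'_def False i_def A_def a_def]
    interpret b: batching f V S A "\<lambda>v. max a (\<theta> v)" by (rule bc(6))
    have R'U: "R' \<subseteq> U" using Suc.prems by (auto simp: R'_def)
    let ?few = "card F \<le> \<delta> * card R'"
    define h where "h M = (if ?few then 2 * a * (card (M \<inter> F) - 8 * (\<delta> * B) * card M) else 0)"
      for M :: "nat set"
    have st: "runs f (stage S (\<lambda>v. max a (\<theta> v)) A B) (\<lambda>q M.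
        q \<le> B * (2 * card A + 1) + 2 \<and> M \<subseteq> A \<and> admissible S (\<lambda>v. max a (\<theta> v)) M \<and>
        \<not> lively f (\<lambda>v. max a (\<theta> v)) (S \<union> M) A)"
      using bc by (intro b.runs_stage) auto
    have eh: "expects f (stage S (\<lambda>v. max a (\<theta> v)) A B) h 0"
    proof (cases ?few)
      case True
      have "card (F \<inter> A) \<le> card F" using F by (intro card_mono) auto
      also have "\<dots> \<le> \<delta> * card R'" by (rule True)
      also have "\<dots> \<le> \<delta> * (B * card A)"
        using bc(4) \<delta>_pos by (intro mult_left_mono) (auto simp flip: of_nat_mult)
      finally have "expects f (stage S (\<lambda>v. max a (\<theta> v)) A B)
          (\<lambda>M. real (card (M \<inter> F)) - 8 * (\<delta> * B) * card M) 0"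
        using bc \<delta>_pos by (intro b.expects_stage) auto
      then show ?thesis using True bc(5) expects_cmult[of f _ _ "2 * a"] by (simp add: h_def[abs_def])
    next
      case False
      have "h = (\<lambda>_. 0)" using False by (auto simp: h_def)
      moreover have "expects f (stage S (\<lambda>v. max a (\<theta> v)) A B)
          (\<lambda>M. real (card (M \<inter> {})) - 8 * (\<delta> * B) * card M) 0"
        using bc \<delta>_pos by (intro b.expects_stage) auto
      ultimately show ?thesis by (simp add: expects_def)
    qed
    have "expects f (bind_comp (stage S (\<lambda>v. max a (\<theta> v)) A B) (\<lambda>M.
            bind_comp (build \<theta> a0 B n (S \<union> M) R') (\<lambda>ls. Ret (Level R' M a {} # ls)))) (surplus F) 0"
    proof (rule expects_bind[OF eh], rule runs_mono[OF st], elim conjE)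
      fix M assume "M \<subseteq> A"
      then have IH: "expects f (build \<theta> a0 B n (S \<union> M) R') (surplus F) 0"
        using Suc.prems bc(3) R'U U_sub by (intro Suc.IH) auto
      show "expects f (bind_comp (build \<theta> a0 B n (S \<union> M) R') (\<lambda>ls. Ret (Level R' M a {} # ls)))
         (surplus F) (h M)"
      proof (cases ?few)
        case True
        have "expects f (bind_comp (build \<theta> a0 B n (S \<union> M) R') (\<lambda>ls. Ret (Level R' M a {} # ls)))
          (surplus F) (0 + h M)"
          using True by (intro expects_bind_Ret[OF IH]) (simp add: h_def algebra_simps)
        then show ?thesis by simp
      next
        case False
        have IH0: "expects f (build \<theta> a0 B n (S \<union> M) R') (\<lambda>_. 0) 0"
          using IH by (simp add: expects_def)
        have "expects f (bind_comp (build \<theta> a0 B n (S \<union> M) R') (\<lambda>ls. Ret (Level R' M a {} # ls)))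
          (surplus F) (0 + 0)"
          using False by (intro expects_bind_Ret[OF IH0]) simp
        then show ?thesis using False by (simp add: h_def)
      qed
    qed
    then show ?thesis
      unfolding build_Suc(2)[OF finR] Let_def R'_def[symmetric] i_def[symmetric]
        A_def[symmetric] a_def[symmetric]
      by (simp only: False if_False)
  qed
qed

text \<open>The update moves \<open>x\<close> from the future into \<open>touched\<close>, so the
  union of both is unchanged for a level that stays. A level that is rebuilt counted 0 before, as it
  was not going to survive, and its replacement has expectation at most 0.\<close>

lemma expects_refresh:
  assumes x: "x \<in> U" and F: "finite F"
  shows "coherent W n S C ls \<Longrightarrow> S \<subseteq> V \<Longrightarrow> C \<subseteq> U \<Longrightarrow>
    expects f (refresh \<theta> a0 B \<delta> x W' n S ls) (surplus F) (surplus (insert x F) ls)"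
proof (induction ls arbitrary: n S C)
  case Nil
  then show ?case by simp
next
  case (Cons l ls)
  define P where "P = insert x (touched l)"
  have "finite (touched l)" using Cons.prems by (intro finite_below_U[of _ C]) auto
  then have finP: "finite P" by (simp add: P_def)
  have PF: "touched l \<union> insert x F = P \<union> F" by (auto simp: P_def)
  show ?case
  proof (cases "card P \<le> \<delta> * card (cands l)")
    case True
    then have ne: "cands l \<noteq> {}" using finP by (auto simp: P_def)
    have bU: "batch l \<subseteq> V" using coherent_batch_sub Cons.prems by blast
    have IH: "expects f (refresh \<theta> a0 B \<delta> x W' (n - 1) (S \<union> batch l) ls) (surplus F) (surplus (insert x F) ls)"
      by (rule Cons.IH[of "n - 1" "S \<union> batch l" "cands l \<union> touched l"])
        (use Cons.prems ne bU in auto)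
    let ?r = "bind_comp (refresh \<theta> a0 B \<delta> x W' (n - 1) (S \<union> batch l) ls)
                (\<lambda>ls'. Ret (Level (cands l) (batch l) (scale l) P # ls'))"
    have "expects f ?r (surplus F) (surplus (insert x F) (l # ls))"
    proof (cases "card (P \<union> F) \<le> \<delta> * card (cands l)")
      case True
      have "expects f ?r (surplus F) (surplus (insert x F) ls +
         (2 * scale l * card (batch l \<inter> (P \<union> F)) - \<eta> * scale l * card (batch l)))"
        using True by (intro expects_bind_Ret[OF IH]) simp
      then show ?thesis using True PF by (simp add: add.commute)
    next
      case False
      have IH0: "expects f (refresh \<theta> a0 B \<delta> x W' (n - 1) (S \<union> batch l) ls) (\<lambda>_. 0) 0"
        using IH by (simp add: expects_def)
      have "expects f ?r (surplus F) (0 + 0)"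
        using False by (intro expects_bind_Ret[OF IH0]) simp
      then show ?thesis using False PF by simp
    qed
    then show ?thesis using True by (simp add: P_def[symmetric] del: surplus.simps)
  next
    case False
    have "card P \<le> card (P \<union> F)" using finP F by (intro card_mono) auto
    then have "surplus (insert x F) (l # ls) = 0" using False PF by simp
    moreover have "expects f (build \<theta> a0 B n S ((cands l \<union> P) \<inter> W')) (surplus F) 0"
      using Cons.prems x by (intro expects_build F) (auto simp: P_def)
    ultimately show ?thesis using False by (simp add: P_def[symmetric] del: surplus.simps)
  qed
qed

section \<open>Cost and value of the surviving elements\<close>

lemma coherent_total_sub: "coherent W n S C ls \<Longrightarrow> total ls \<subseteq> C"
proof (induction ls arbitrary: n S C)
  case Nil
  then show ?case by simp
next
  case (Cons l ls)
  show ?case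
  proof (cases "cands l = {}")
    case True
    then show ?thesis using Cons.prems by auto
  next
    case False
    then have "total ls \<subseteq> cands l \<union> touched l"
      using Cons.prems by (intro Cons.IH[of "n - 1" "S \<union> batch l"]) auto
    then show ?thesis using Cons.prems by auto
  qed
qed

text \<open>The last level has neither candidates nor touched elements, yet these would have to
  include every present live element.\<close>

lemma coherent_not_live:
  "coherent W n S C ls \<Longrightarrow> C \<subseteq> U \<Longrightarrow> v \<in> U \<inter> W \<Longrightarrow> \<not> live f \<theta> (S \<union> total ls) v"
proof (induction ls arbitrary: n S C)
  case Nil
  then show ?case by simp
next
  case (Cons l ls)
  show ?case
  proof (cases "cands l = {}")
    case True
    have "finite (touched l)" using Cons.prems by (intro finite_below_U[of _ C]) auto
    then have "touched l = {}" using Cons.prems True by auto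
    then show ?thesis using Cons.prems True by auto
  next
    case False
    have "\<not> live f \<theta> ((S \<union> batch l) \<union> total ls) v"
      by (rule Cons.IH[of "n - 1" _ "cands l \<union> touched l"]) (use Cons.prems False in auto)
    then show ?thesis by (simp add: Un_assoc)
  qed
qed

text \<open>\<open>Z\<close> stands for the survivors of earlier batches, which form only a subset
  of the base \<open>S\<close>. As \<theta> is proportional to the weights, this bounds the cost of
  the output.\<close>

lemma coherent_kept_gain:
  "coherent W n S C ls \<Longrightarrow> C \<subseteq> U \<Longrightarrow> Z \<subseteq> S \<Longrightarrow> f Z + sum \<theta> (total ls \<inter> W) \<le> f (Z \<union> (total ls \<inter> W))"
proof (induction ls arbitrary: n S C Z)
  case Nil
  then show ?case by simp
next
  case (Cons l ls)
  let ?K = "batch l \<inter> W"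
  have fin: "finite (batch l)" using Cons.prems by (intro finite_below_U[of _ C]) auto
  have tU: "total (l # ls) \<subseteq> U" using coherent_total_sub[OF Cons.prems(1)] Cons.prems(2) by blast
  have tV: "total ls \<subseteq> V" "batch l \<subseteq> V" using tU U_sub by auto
  have fint: "finite (total ls)" using tV finite_V finite_subset by blast
  have "sum \<theta> ?K \<le> sum (\<lambda>v. max (scale l) (\<theta> v)) ?K" by (intro sum_mono) auto
  moreover have "f Z + sum (\<lambda>v. max (scale l) (\<theta> v)) ?K \<le> f (Z \<union> ?K)"
    by (rule admissibleD[of S]) (use Cons.prems in auto)
  moreover have "f (Z \<union> ?K) + sum \<theta> (total ls \<inter> W) \<le> f (Z \<union> ?K \<union> (total ls \<inter> W))"
  proof (cases "cands l = {}")
    case True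
    then show ?thesis using Cons.prems by auto
  next
    case False
    then show ?thesis
      by (intro Cons.IH[of "n - 1" "S \<union> batch l" "cands l \<union> touched l"]) (use Cons.prems in auto)
  qed
  moreover have "sum \<theta> (total (l # ls) \<inter> W) \<le> sum \<theta> ?K + sum \<theta> (total ls \<inter> W)"
  proof -
    have "sum \<theta> (?K \<union> (total ls \<inter> W)) + sum \<theta> (?K \<inter> (total ls \<inter> W)) = sum \<theta> ?K + sum \<theta> (total ls \<inter> W)"
      using fin fint by (intro sum.union_inter) auto
    moreover have "0 \<le> sum \<theta> (?K \<inter> (total ls \<inter> W))"
      using tV \<theta>_pos by (intro sum_nonneg) (auto intro: less_imp_le)
    moreover have "total (l # ls) \<inter> W = ?K \<union> (total ls \<inter> W)" by auto
    ultimately show ?thesis by simp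
  qed
  moreover have "Z \<union> ?K \<union> (total ls \<inter> W) = Z \<union> (total (l # ls) \<inter> W)" by auto
  ultimately show ?case by simp
qed

definition gain :: "level list \<Rightarrow> real" where
  "gain ls = (\<Sum>l\<leftarrow>ls. scale l * card (batch l))"

definition loss :: "level list \<Rightarrow> real" where
  "loss ls = (\<Sum>l\<leftarrow>ls. 2 * scale l * card (batch l \<inter> touched l))"

lemma coherent_gain:
  "coherent W n S C ls \<Longrightarrow> C \<subseteq> U \<Longrightarrow> f S + gain ls \<le> f (S \<union> total ls)"
proof (induction ls arbitrary: n S C)
  case Nil
  then show ?case by simp
next
  case (Cons l ls)
  have "(\<Sum>v\<in>batch l. scale l) \<le> sum (\<lambda>v. max (scale l) (\<theta> v)) (batch l)" by (intro sum_mono) auto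
  moreover have "f S + sum (\<lambda>v. max (scale l) (\<theta> v)) (batch l) \<le> f (S \<union> batch l)"
    by (rule admissibleD[of S]) (use Cons.prems in auto)
  moreover have "f (S \<union> batch l) + gain ls \<le> f (S \<union> batch l \<union> total ls)"
  proof (cases "cands l = {}")
    case True
    then show ?thesis using Cons.prems by (auto simp: gain_def)
  next
    case False
    then show ?thesis
      by (intro Cons.IH[of "n - 1" _ "cands l \<union> touched l"]) (use Cons.prems in auto)
  qed
  ultimately show ?case by (simp add: gain_def Un_assoc mult.commute)
qed

text \<open>A vanished element is charged its gain over the base of its batch, at most twice the
  scale, whatever else is missing.\<close>

lemma coherent_loss:
  "coherent W n S C ls \<Longrightarrow> S \<subseteq> V \<Longrightarrow> C \<subseteq> U \<Longrightarrow> f (S \<union> total ls) \<le> f (S \<union> (total ls \<inter> W)) + loss ls"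
proof (induction ls arbitrary: n S C)
  case Nil
  then show ?case by (simp add: loss_def)
next
  case (Cons l ls)
  have bV: "batch l \<subseteq> V" using coherent_batch_sub Cons.prems by blast
  have fin: "finite (batch l)" using bV finite_V finite_subset by blast
  have tV: "total ls \<subseteq> V" using coherent_total_sub[OF Cons.prems(1)] Cons.prems(3) U_sub by auto
  let ?T = "S \<union> (batch l \<inter> W) \<union> (total ls \<inter> W)" and ?D = "batch l - W"
  have "f (S \<union> batch l \<union> total ls) \<le> f (S \<union> batch l \<union> (total ls \<inter> W)) + loss ls"
  proof (cases "cands l = {}")
    case True
    then show ?thesis using Cons.prems by (auto simp: loss_def)
  next
    case False
    then show ?thesis
      by (intro Cons.IH[of "n - 1" _ "cands l \<union> touched l"]) (use Cons.prems bV in auto)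
  qed
  moreover have "S \<union> batch l \<union> (total ls \<inter> W) = ?T \<union> ?D" by auto
  moreover have "f (?T \<union> ?D) - f ?T \<le> (\<Sum>v\<in>?D. f (insert v S) - f S)"
    using Cons.prems bV tV by (intro union_le_sum_gains) auto
  moreover have "\<dots> \<le> (\<Sum>v\<in>?D. 2 * scale l)"
    using Cons.prems by (intro sum_mono) auto
  moreover have "\<dots> \<le> 2 * scale l * card (batch l \<inter> touched l)"
  proof -
    have "card ?D \<le> card (batch l \<inter> touched l)"
      using Cons.prems fin by (intro card_mono) auto
    then have "2 * scale l * card ?D \<le> 2 * scale l * card (batch l \<inter> touched l)"
      using Cons.prems by (intro mult_left_mono) auto
    then show ?thesis by (simp add: mult.commute)
  qed
  moreover have "S \<union> (total (l # ls) \<inter> W) = ?T" by auto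
  ultimately show ?case by (simp add: loss_def Un_assoc)
qed

lemma coherent_surplus: "coherent W n S C ls \<Longrightarrow> surplus {} ls = loss ls - \<eta> * gain ls \<and> 0 \<le> gain ls \<and> 0 \<le> loss ls"
proof (induction ls arbitrary: n S C)
  case Nil
  then show ?case by simp
next
  case (Cons l ls)
  have "surplus {} ls = loss ls - \<eta> * gain ls \<and> 0 \<le> gain ls \<and> 0 \<le> loss ls"
  proof (cases "cands l = {}")
    case True
    then show ?thesis using Cons.prems by (simp add: gain_def loss_def)
  next
    case False
    then show ?thesis
      by (intro Cons.IH[of "n - 1" "S \<union> batch l" "cands l \<union> touched l"]) (use Cons.prems in auto)
  qed
  then show ?case using Cons.prems by (simp add: gain_def loss_def algebra_simps)
qed

text \<open>The gain is bounded by the value of all batches, deleted elements included, hence only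
  by \<open>f W + loss ls\<close>. Inserted into \<open>loss = surplus + \<eta> * gain\<close>, this
  leaves \<open>\<eta> * loss\<close> on the right; \<open>\<eta> \<le> 1 / 2\<close> absorbs it at
  the price of the factors 2.\<close>

lemma coherent_kept_value:
  assumes i: "coherent W n {} U ls" and "W \<subseteq> V" and "\<eta> \<le> 1 / 2"
  shows "f (total ls) - f (total ls \<inter> W) \<le> 2 * surplus {} ls + 2 * \<eta> * f W"
proof -
  have l: "f (total ls) \<le> f (total ls \<inter> W) + loss ls" using coherent_loss[OF i] by simp
  have "f {} + gain ls \<le> f (total ls)" using coherent_gain[OF i] by simp
  moreover have "0 \<le> f {}" by (rule nonneg) simp
  moreover have "f (total ls \<inter> W) \<le> f W" using assms by (intro mono) auto
  ultimately have g: "gain ls \<le> f W + loss ls" using l by linarith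
  have s: "surplus {} ls = loss ls - \<eta> * gain ls" "0 \<le> loss ls" using coherent_surplus[OF i] by auto
  have "\<eta> * gain ls \<le> \<eta> * (f W + loss ls)"
    using g \<delta>_pos by (intro mult_left_mono) auto
  moreover have "\<eta> * loss ls \<le> 1 / 2 * loss ls"
    using assms(3) s(2) by (rule mult_right_mono)
  ultimately have "loss ls \<le> 2 * surplus {} ls + 2 * \<eta> * f W"
    using s(1) by (simp add: algebra_simps)
  then show ?thesis using l by linarith
qed

end

section \<open>Algorithms with an explicit state\<close>

fun answer_of :: "event \<Rightarrow> real" where
  "answer_of (EAns A y) = y"
| "answer_of _ = 0"

fun sample_of :: "event \<Rightarrow> nat" where
  "sample_of (ERnd i) = i"
| "sample_of _ = 0"

fun update_of :: "event \<Rightarrow> upd" where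
  "update_of (EUpd x) = x"
| "update_of _ = Ins 0"

primrec resume :: "'r comp \<Rightarrow> event list \<Rightarrow> 'r \<times> event list" where
  "resume (Ret r) es = (r, es)"
| "resume (Qry A k) es = resume (k (answer_of (hd es))) (tl es)"
| "resume (Samp p k) es = resume (k (sample_of (hd es))) (tl es)"

lemma resume_run: "(es, r) \<in> set_pmf (run_comp f c) \<Longrightarrow> resume c (es @ rest) = (r, rest)"
proof (induction c arbitrary: es)
  case (Ret x)
  then show ?case by simp
next
  case (Qry A k)
  then obtain es' where "(es', r) \<in> set_pmf (run_comp f (k (f A)))" "es = EAns A (f A) # es'"
    by auto
  then show ?case using Qry.IH by simp
next
  case (Samp p k)
  then obtain i es' where "(es', r) \<in> set_pmf (run_comp f (k i))" "es = ERnd i # es'"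
    by auto
  then show ?case using Samp.IH by simp
qed

primrec replay :: "(upd \<Rightarrow> 's \<Rightarrow> 's comp) \<Rightarrow> nat \<Rightarrow> 's \<Rightarrow> event list \<Rightarrow> 's" where
  "replay step 0 s tr = s"
| "replay step (Suc n) s tr =
     (if tr = [] then s
      else case resume (step (update_of (hd tr)) s) (tl tr) of (s', tr') \<Rightarrow> replay step n s' tr')"

lemma replay_Nil [simp]: "replay step n s [] = s"
  by (cases n) auto

text \<open>An algorithm receives only the transcript, so the state is recomputed from the recorded
  answers and samples, without new queries. The length of the transcript suffices as fuel because
  every update left at least one event.\<close>

definition stateful :: "(upd \<Rightarrow> 's \<Rightarrow> 's comp) \<Rightarrow> 's \<Rightarrow> ('s \<Rightarrow> nat set) \<Rightarrow> event list \<Rightarrow> nat set comp" where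
  "stateful step s0 out tr =
     bind_comp (step (update_of (last tr)) (replay step (length tr) s0 (butlast tr))) (\<lambda>s. Ret (out s))"

primrec exec_state :: "(nat set \<Rightarrow> real) \<Rightarrow> (upd \<Rightarrow> 's \<Rightarrow> 's comp) \<Rightarrow> 's \<Rightarrow> (nat \<Rightarrow> upd) \<Rightarrow> nat \<Rightarrow>
    (event list \<times> 's) pmf" where
  "exec_state f step s0 u 0 = return_pmf ([], s0)"
| "exec_state f step s0 u (Suc t) =
     bind_pmf (exec_state f step s0 u t) (\<lambda>(tr, s).
       map_pmf (\<lambda>(es, s'). (tr @ [EUpd (u t)] @ es, s')) (run_comp f (step (u t) s)))"

text \<open>The unread events \<open>rest\<close> and the spare fuel \<open>m\<close> are general so
  that the induction can append a step.\<close>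

lemma replay_exec_state:
  "(tr, s) \<in> set_pmf (exec_state f step s0 u t) \<Longrightarrow>
     t \<le> length tr \<and> replay step (t + m) s0 (tr @ rest) = replay step m s rest"
proof (induction t arbitrary: tr s m rest)
  case 0
  then show ?case by simp
next
  case (Suc t)
  then obtain tr' s' es where *: "(tr', s') \<in> set_pmf (exec_state f step s0 u t)"
    "(es, s) \<in> set_pmf (run_comp f (step (u t) s'))" "tr = tr' @ [EUpd (u t)] @ es"
    by auto
  have "replay step (t + Suc m) s0 (tr' @ EUpd (u t) # es @ rest) =
      replay step (Suc m) s' (EUpd (u t) # es @ rest)"
    using Suc.IH[OF *(1)] by blast
  also have "\<dots> = replay step m s rest"
    using resume_run[OF *(2), of rest] by simp
  finally show ?case using Suc.IH[OF *(1), of 0 "[]"] * by simp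
qed

lemma exec_stateful:
  assumes "out s0 = {}"
  shows "exec f (stateful step s0 out) u t =
    map_pmf (\<lambda>(tr, s). (tr, out s)) (exec_state f step s0 u t)"
proof (induction t)
  case 0
  then show ?case using assms by simp
next
  case (Suc t)
  have run: "run_comp f (stateful step s0 out (tr @ [EUpd (u t)])) =
      map_pmf (\<lambda>(es, s'). (es, out s')) (run_comp f (step (u t) s))"
    if "(tr, s) \<in> set_pmf (exec_state f step s0 u t)" for tr s
  proof -
    have len: "t \<le> length tr" using replay_exec_state[OF that] by blast
    then have "replay step (t + (Suc (length tr) - t)) s0 (tr @ []) = s"
      using replay_exec_state[OF that, of "Suc (length tr) - t" "[]"] by (simp only: replay_Nil)
    moreover have "t + (Suc (length tr) - t) = length (tr @ [EUpd (u t)])" using len by simp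
    ultimately have "replay step (length (tr @ [EUpd (u t)])) s0 tr = s" by (simp only: append_Nil2)
    then show ?thesis
      by (simp add: stateful_def run_comp_bind map_pmf_def bind_return_pmf case_prod_unfold del: replay.simps)
  qed
  have "exec f (stateful step s0 out) u (Suc t) =
    bind_pmf (exec_state f step s0 u t) (\<lambda>(tr, s).
       map_pmf (\<lambda>(es, S). (tr @ [EUpd (u t)] @ es, S))
         (run_comp f (stateful step s0 out (tr @ [EUpd (u t)]))))"
    by (simp add: Suc.IH bind_map_pmf case_prod_unfold)
  also have "\<dots> = bind_pmf (exec_state f step s0 u t) (\<lambda>(tr, s).
       map_pmf (\<lambda>(es, S). (tr @ [EUpd (u t)] @ es, S))
         (map_pmf (\<lambda>(es, s'). (es, out s')) (run_comp f (step (u t) s))))"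
    by (intro bind_pmf_cong refl) (auto simp: run)
  also have "\<dots> = map_pmf (\<lambda>(tr, s). (tr, out s)) (exec_state f step s0 u (Suc t))"
    by (simp add: map_bind_pmf map_pmf_comp case_prod_unfold)
  finally show ?case .
qed

lemma exec_state_invariant:
  assumes "Q 0 0 s0"
    and "\<And>t n s. Q t n s \<Longrightarrow> runs f (step (u t) s) (\<lambda>m. Q (Suc t) (n + m))"
  shows "(tr, s) \<in> set_pmf (exec_state f step s0 u t) \<Longrightarrow> Q t (num_queries tr) s"
proof (induction t arbitrary: tr s)
  case 0
  then show ?case using assms by simp
next
  case (Suc t)
  then obtain tr' s' es where *: "(tr', s') \<in> set_pmf (exec_state f step s0 u t)"
    "(es, s) \<in> set_pmf (run_comp f (step (u t) s'))" "tr = tr' @ [EUpd (u t)] @ es"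
    by auto
  then show ?case using assms(2)[OF Suc.IH[OF *(1)]] by (auto simp: runs_def)
qed

text \<open>Without their transcripts the states form a Markov chain, on which expectations are
  computed.\<close>

lemma states_exec_state:
  "map_pmf snd (exec_state f step s0 u (Suc t)) =
     bind_pmf (map_pmf snd (exec_state f step s0 u t)) (\<lambda>s. result f (step (u t) s))"
  by (simp add: map_bind_pmf map_pmf_comp bind_map_pmf result_def case_prod_unfold)

section \<open>Updating several structures\<close>

primrec update_all :: "('i \<Rightarrow> 'l \<Rightarrow> 'l comp) \<Rightarrow> 'i list \<Rightarrow> ('i \<Rightarrow> 'l) \<Rightarrow> ('i \<Rightarrow> 'l) comp" where
  "update_all c [] L = Ret L"
| "update_all c (j # js) L = bind_comp (c j (L j)) (\<lambda>l. update_all c js (L(j := l)))"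

lemma runs_update_all:
  "distinct js \<Longrightarrow> (\<And>j. j \<in> set js \<Longrightarrow> runs f (c j (L j)) (Q j)) \<Longrightarrow>
   runs f (update_all c js L) (\<lambda>q L'. (\<forall>j. j \<notin> set js \<longrightarrow> L' j = L j) \<and>
     (\<exists>k. (\<forall>j\<in>set js. Q j (k j) (L' j)) \<and> q = sum k (set js)))"
proof (induction js arbitrary: L)
  case Nil
  then show ?case by simp
next
  case (Cons i js)
  have "runs f (c i (L i)) (Q i)" using Cons.prems by simp
  then show ?case
    unfolding update_all.simps runs_bind
  proof (rule runs_mono)
    fix n l assume l: "Q i n l"
    have "runs f (c j ((L(i := l)) j)) (Q j)" if "j \<in> set js" for j
      using that Cons.prems by auto
    then have "runs f (update_all c js (L(i := l))) (\<lambda>q L'.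
        (\<forall>j. j \<notin> set js \<longrightarrow> L' j = (L(i := l)) j) \<and>
        (\<exists>k. (\<forall>j\<in>set js. Q j (k j) (L' j)) \<and> q = sum k (set js)))"
      using Cons.prems by (intro Cons.IH) auto
    then show "runs f (update_all c js (L(i := l))) (\<lambda>m L'.
        (\<forall>j. j \<notin> set (i # js) \<longrightarrow> L' j = L j) \<and>
        (\<exists>k. (\<forall>j\<in>set (i # js). Q j (k j) (L' j)) \<and> n + m = sum k (set (i # js))))"
    proof (rule runs_mono, elim conjE exE, intro conjI)
      fix m L' k assume L': "\<forall>j. j \<notin> set js \<longrightarrow> L' j = (L(i := l)) j"
        and k: "\<forall>j\<in>set js. Q j (k j) (L' j)" "m = sum k (set js)"
      show "\<forall>j. j \<notin> set (i # js) \<longrightarrow> L' j = L j" using L' by auto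
      have "sum (k(i := n)) (set js) = sum k (set js)"
        using Cons.prems(1) by (intro sum.cong) auto
      then have "(\<forall>j\<in>set (i # js). Q j ((k(i := n)) j) (L' j)) \<and>
          n + m = sum (k(i := n)) (set (i # js))"
        using Cons.prems(1) k L' l by auto
      then show "\<exists>k. (\<forall>j\<in>set (i # js). Q j (k j) (L' j)) \<and> n + m = sum k (set (i # js))" by blast
    qed
  qed
qed

text \<open>Each computation reads only its own component, so a single threshold can be analysed as
  if it were maintained alone.\<close>

lemma result_update_all:
  "distinct js \<Longrightarrow> map_pmf (\<lambda>L'. L' j) (result f (update_all c js L)) =
     (if j \<in> set js then result f (c j (L j)) else return_pmf (L j))"
proof (induction js arbitrary: L)
  case Nil
  then show ?case by simp
next
  case (Cons i js)
  show ?case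
  proof (cases "j = i")
    case True
    then show ?thesis using Cons by (simp add: map_bind_pmf bind_return_pmf')
  next
    case False
    then show ?thesis using Cons by (auto simp: map_bind_pmf)
  qed
qed

lemma finite_update_all:
  "distinct js \<Longrightarrow> (\<And>j. j \<in> set js \<Longrightarrow> finite (set_pmf (result f (c j (L j))))) \<Longrightarrow>
     finite (set_pmf (result f (update_all c js L)))"
proof (induction js arbitrary: L)
  case Nil
  then show ?case by simp
next
  case (Cons i js)
  have "finite (set_pmf (result f (update_all c js (L(i := l)))))" for l
    using Cons.prems by (intro Cons.IH) auto
  then show ?case using Cons.prems by simp
qed

section \<open>The dynamic algorithm\<close>

definition scales :: "real \<Rightarrow> real \<Rightarrow> int set" where
  "scales a b = {j. a \<le> 2 powr j \<and> 2 powr j \<le> b}"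

lemma scales_bounded:
  assumes "b < 2 ^ n * a" "0 < b"
  shows "finite (scales a b)" "card (scales a b) \<le> n"
proof -
  have a: "0 < a" using assms by (metis less_trans zero_less_mult_pos zero_less_numeral zero_less_power)
  have "scales a b \<subseteq> {\<lceil>log 2 a\<rceil> ..< \<lceil>log 2 a\<rceil> + int n}"
  proof
    fix j assume "j \<in> scales a b"
    then have j: "a \<le> 2 powr j" "2 powr j \<le> b" by (auto simp: scales_def)
    have "log 2 a \<le> j" using j a by (simp add: log_le_iff)
    then have "\<lceil>log 2 a\<rceil> \<le> j" by (simp add: ceiling_le_iff)
    have "2 powr j < 2 ^ n * a" using j assms by linarith
    then have "log 2 (2 powr j) < log 2 (2 ^ n * a)" using a by (subst log_less_cancel_iff) auto
    then have "real_of_int j < n + log 2 a" using a by (simp add: log_mult log_nat_power)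
    then have "real_of_int j < of_int (\<lceil>log 2 a\<rceil> + int n)"
      using le_of_int_ceiling[of "log 2 a"] by simp linarith
    then have "j < \<lceil>log 2 a\<rceil> + int n" by linarith
    with \<open>\<lceil>log 2 a\<rceil> \<le> j\<close> show "j \<in> {\<lceil>log 2 a\<rceil> ..< \<lceil>log 2 a\<rceil> + int n}" by simp
  qed
  then show "finite (scales a b)" "card (scales a b) \<le> n"
    using finite_subset card_mono[of "{\<lceil>log 2 a\<rceil> ..< \<lceil>log 2 a\<rceil> + int n}" "scales a b"] by auto
qed

definition wmin :: "nat set \<Rightarrow> (nat \<Rightarrow> real) \<Rightarrow> real" where "wmin V w = Min (w ` V)"
definition wmax :: "nat set \<Rightarrow> (nat \<Rightarrow> real) \<Rightarrow> real" where "wmax V w = Max (w ` V)"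

text \<open>Its power of two exceeds \<open>2 * card V * wratio w V / \<epsilon>\<close>. One number
  thereby bounds the thresholds relevant to an element, the guesses, the gain classes and the
  doubling rounds of a batch.\<close>

definition num_scales :: "nat set \<Rightarrow> (nat \<Rightarrow> real) \<Rightarrow> real \<Rightarrow> nat" where
  "num_scales V w \<epsilon> = Suc (nat \<lceil>log 2 (2 * card V * wratio w V / \<epsilon>)\<rceil>)"

text \<open>With \<open>B\<close> for \<open>num_scales V w \<epsilon>\<close>, 16 times this value
  times \<open>B\<close> is \<open>\<epsilon> / (2 * B ^ 2)\<close>; twice that, summed over
  \<open>B\<close> guesses, is at most \<epsilon>.\<close>

definition tolerance :: "nat set \<Rightarrow> (nat \<Rightarrow> real) \<Rightarrow> real \<Rightarrow> real" where
  "tolerance V w \<epsilon> = \<epsilon> / (32 * real (num_scales V w \<epsilon>) ^ 3)"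

definition depth :: "nat set \<Rightarrow> (nat \<Rightarrow> real) \<Rightarrow> real \<Rightarrow> nat" where
  "depth V w \<epsilon> = 16 * num_scales V w \<epsilon> ^ 3"

text \<open>An element of singleton gain \<open>y\<close> only matters for the density thresholds \<open>2 powr j\<close> that it
  reaches and that can be \<open>\<epsilon> * F / c\<close> for some \<open>F \<ge> y\<close> and some cost \<open>c\<close>. The thresholds are tied
  to the elements, not to the current value of \<open>f\<close>, as that value may vary without bounds.\<close>

definition relevant :: "nat set \<Rightarrow> (nat \<Rightarrow> real) \<Rightarrow> real \<Rightarrow> nat \<Rightarrow> real \<Rightarrow> int set" where
  "relevant V w \<epsilon> x y = (if 0 < y then scales (\<epsilon> * y / (2 * card V * wmax V w)) (y / w x) else {})"

text \<open>The range of \<open>\<epsilon> * F / c\<close> for a cost \<open>c\<close> between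
  \<open>wmin V w\<close> and \<open>card V * wmax V w\<close>; the factor 2 leaves room for
  rounding down to a power of two.\<close>

definition guesses :: "nat set \<Rightarrow> (nat \<Rightarrow> real) \<Rightarrow> real \<Rightarrow> real \<Rightarrow> int set" where
  "guesses V w \<epsilon> F = (if 0 < F then scales (\<epsilon> * F / (2 * card V * wmax V w)) (\<epsilon> * F / wmin V w) else {})"

type_synonym state = "nat set \<times> (int \<Rightarrow> level list) \<times> nat set"

definition present :: "upd \<Rightarrow> nat set \<Rightarrow> nat set" where
  "present x W = (case x of Ins v \<Rightarrow> insert v W | Del v \<Rightarrow> W - {v})"

definition refresh_scale :: "nat set \<Rightarrow> (nat \<Rightarrow> real) \<Rightarrow> real \<Rightarrow> nat \<Rightarrow> nat set \<Rightarrow> int \<Rightarrow>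
    level list \<Rightarrow> level list comp" where
  "refresh_scale V w \<epsilon> x W j ls =
     refresh (\<lambda>v. 2 powr j * w v) (2 powr j * wmin V w) (num_scales V w \<epsilon>) (tolerance V w \<epsilon>) x W
       (depth V w \<epsilon>) {} ls"

text \<open>The cost bound \<open>F / 2 powr j\<close> improves with \<open>j\<close>, hence the
  maximum. The sets tested include deleted elements: for these sets the guess made from the optimal
  cost passes in every run.\<close>

definition choose_scale :: "nat set \<Rightarrow> (nat \<Rightarrow> real) \<Rightarrow> real \<Rightarrow> real \<Rightarrow> (nat set \<Rightarrow> real) \<Rightarrow>
    (int \<Rightarrow> level list) \<Rightarrow> int" where
  "choose_scale V w \<epsilon> F h L = Max {j \<in> guesses V w \<epsilon> F. (1 - \<epsilon>) * F \<le> h (total (L j))}"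

definition step :: "nat set \<Rightarrow> (nat \<Rightarrow> real) \<Rightarrow> real \<Rightarrow> upd \<Rightarrow> state \<Rightarrow> state comp" where
  "step V w \<epsilon> up = (\<lambda>(W, L, _).
     let x = upd_elem up; W' = present up W in
     bind_comp (query_all [{}, {x}, W']) (\<lambda>h.
     bind_comp (update_all (refresh_scale V w \<epsilon> x W')
       (sorted_list_of_set (relevant V w \<epsilon> x (h {x} - h {}))) L) (\<lambda>L'.
     bind_comp (query_all (map (\<lambda>j. total (L' j)) (sorted_list_of_set (guesses V w \<epsilon> (h W'))))) (\<lambda>h'.
     Ret (W', L', if (1 - \<epsilon>) * h W' \<le> h {} then {}
                  else total (L' (choose_scale V w \<epsilon> (h W') h' L')) \<inter> W')))))"

definition initial :: state where "initial = ({}, \<lambda>_. [Level {} {} 0 {}], {})"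

locale cover = submodular +
  fixes w :: "nat \<Rightarrow> real" and \<epsilon> :: real
  assumes V_ne: "V \<noteq> {}" and w_pos: "\<And>v. v \<in> V \<Longrightarrow> 0 < w v" and \<epsilon>: "0 < \<epsilon>" "\<epsilon> < 1"
begin

abbreviation "B \<equiv> num_scales V w \<epsilon>"
abbreviation "N \<equiv> depth V w \<epsilon>"
abbreviation "\<delta> \<equiv> tolerance V w \<epsilon>"
abbreviation "lo \<equiv> wmin V w"
abbreviation "hi \<equiv> wmax V w"

definition U :: "int \<Rightarrow> nat set" where
  "U j = {x \<in> V. j \<in> relevant V w \<epsilon> x (f {x} - f {})}"

lemma lo_le: "v \<in> V \<Longrightarrow> lo \<le> w v" and le_hi: "v \<in> V \<Longrightarrow> w v \<le> hi"
  using finite_V by (auto simp: wmin_def wmax_def)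

lemma lo_pos: "0 < lo"
  using finite_V V_ne w_pos by (simp add: wmin_def)

lemma lo_le_hi: "lo \<le> hi"
  using V_ne lo_le le_hi by fastforce

lemma hi_pos: "0 < hi"
  using lo_pos lo_le_hi by linarith

lemma card_pos: "0 < card V"
  using finite_V V_ne by (simp add: card_gt_0_iff)

lemma ratio: "wratio w V = hi / lo"
  by (simp add: wratio_def wmin_def wmax_def)

lemma ratio_ge1: "1 \<le> wratio w V"
  using lo_pos lo_le_hi by (simp add: ratio)

lemma ratio_less: "2 * card V * hi / (\<epsilon> * lo) < 2 ^ B"
proof -
  let ?r = "2 * card V * wratio w V / \<epsilon>"
  have r: "0 < ?r" using ratio_ge1 card_pos \<epsilon> by simp
  have "?r = 2 powr (log 2 ?r)" using r by simp
  also have "\<dots> < 2 powr (real B)"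
  proof (rule powr_less_mono)
    show "log 2 ?r < real B" unfolding num_scales_def by linarith
  qed simp
  also have "\<dots> = 2 ^ B" by (simp add: powr_realpow)
  finally show ?thesis by (simp add: ratio mult.commute)
qed

lemma card_less: "card V < 2 ^ B"
proof -
  have "1 * real (card V) \<le> 2 * hi / (\<epsilon> * lo) * card V"
  proof (rule mult_right_mono)
    have "\<epsilon> * lo \<le> 1 * lo" using \<epsilon> lo_pos by (intro mult_right_mono) auto
    then have "\<epsilon> * lo \<le> 2 * hi" using lo_le_hi hi_pos by linarith
    then show "1 \<le> 2 * hi / (\<epsilon> * lo)" using \<epsilon> lo_pos by simp
  qed simp
  also have "\<dots> = 2 * card V * hi / (\<epsilon> * lo)" by simp
  also have "\<dots> < 2 ^ B" by (rule ratio_less)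
  finally have "real (card V) < real (2 ^ B)" by simp
  then show ?thesis by (simp only: of_nat_less_iff)
qed

lemma B_pos: "0 < B"
  by (simp add: num_scales_def)

lemma gain_singleton_le:
  assumes "v \<in> V" "S \<subseteq> V"
  shows "f (insert v S) - f S \<le> f {v} - f {}"
  using gain_antimono[of "{}" S v] assms by simp

lemma relevant_bounded: "x \<in> V \<Longrightarrow> finite (relevant V w \<epsilon> x y) \<and> card (relevant V w \<epsilon> x y) \<le> B"
proof (cases "0 < y")
  case True
  assume x: "x \<in> V"
  have "y / w x \<le> y / lo" using True lo_pos lo_le[OF x] by (intro divide_left_mono) (auto intro: mult_pos_pos w_pos x)
  also have "\<dots> = 2 * card V * hi / (\<epsilon> * lo) * (\<epsilon> * y / (2 * card V * hi))"
    using \<epsilon> hi_pos card_pos by (simp add: field_simps)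
  also have "\<dots> < 2 ^ B * (\<epsilon> * y / (2 * card V * hi))"
    using ratio_less \<epsilon> True hi_pos card_pos by (intro mult_strict_right_mono) auto
  finally show ?thesis
    using scales_bounded[of "y / w x" B "\<epsilon> * y / (2 * card V * hi)"] True w_pos[OF x]
    by (simp add: relevant_def)
next
  case False
  then show ?thesis by (simp add: relevant_def)
qed

lemma guesses_bounded: "finite (guesses V w \<epsilon> F) \<and> card (guesses V w \<epsilon> F) \<le> B"
proof (cases "0 < F")
  case True
  have "\<epsilon> * F / lo \<le> F / lo" using True lo_pos \<epsilon> by (intro divide_right_mono) auto
  also have "\<dots> = 2 * card V * hi / (\<epsilon> * lo) * (\<epsilon> * F / (2 * card V * hi))"
    using \<epsilon> hi_pos card_pos by (simp add: field_simps)
  also have "\<dots> < 2 ^ B * (\<epsilon> * F / (2 * card V * hi))"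
    using ratio_less \<epsilon> True hi_pos card_pos by (intro mult_strict_right_mono) auto
  finally show ?thesis
    using scales_bounded[of "\<epsilon> * F / lo" B "\<epsilon> * F / (2 * card V * hi)"] True lo_pos \<epsilon>
    by (simp add: guesses_def)
next
  case False
  then show ?thesis by (simp add: guesses_def)
qed

text \<open>By Bernoulli, \<open>8 * B ^ 2\<close> factors amount to at least 2, and
  \<open>2 * B\<close> doublings exceed \<open>B * card V\<close>, as both of its factors are below
  \<open>2 ^ B\<close>.\<close>

lemma depth_large: "B * card V < (1 + 1 / (8 * B ^ 2) :: real) ^ N"
proof -
  let ?x = "1 / (8 * real B ^ 2)"
  have "1 + real (8 * B ^ 2) * ?x \<le> (1 + ?x) ^ (8 * B ^ 2)"
    by (rule Bernoulli_inequality) (use order_trans[of "-1" 0 ?x] in auto)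
  then have "2 \<le> (1 + ?x) ^ (8 * B ^ 2)" using B_pos by simp
  then have "2 ^ (2 * B) \<le> ((1 + ?x) ^ (8 * B ^ 2)) ^ (2 * B)" by (intro power_mono) auto
  also have "\<dots> = (1 + ?x) ^ N"
    by (simp add: depth_def power2_eq_square power3_eq_cube mult_ac flip: power_mult)
  finally have 1: "2 ^ (2 * B) \<le> (1 + ?x) ^ N" .
  have "B * card V < 2 ^ B * 2 ^ B"
    using card_less less_exp[of B] by (intro mult_strict_mono) auto
  also have "\<dots> = 2 ^ (2 * B)" by (simp add: mult_2 power_add)
  finally have "real (B * card V) < real (2 ^ (2 * B))" by (simp only: of_nat_less_iff)
  then show ?thesis using 1 by simp
qed

lemma leveled_scale: "leveled f V (\<lambda>v. 2 powr real_of_int j * w v) (2 powr j * lo) B N \<delta> (U j)"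
proof (unfold_locales)
  show "U j \<subseteq> V" by (auto simp: U_def)
  show "0 < 2 powr real_of_int j * lo" using lo_pos by simp
  show "2 powr real_of_int j * lo \<le> 2 powr real_of_int j * w v" if "v \<in> V" for v
    using lo_le[OF that] by simp
  \<comment> \<open>The lower end of the range in \<open>relevant\<close> is what caps the gains in
    \<open>U j\<close>.\<close>
  show "f {v} - f {} < 2 powr real_of_int j * lo * 2 ^ B" if "v \<in> U j" for v
  proof -
    let ?y = "f {v} - f {}"
    have "0 < ?y" "\<epsilon> * ?y / (2 * card V * hi) \<le> 2 powr j"
      using that by (auto simp: U_def relevant_def scales_def split: if_splits)
    then have "?y \<le> 2 powr j * (2 * card V * hi / \<epsilon>)"
      using \<epsilon> hi_pos card_pos by (simp add: field_simps)
    also have "\<dots> < 2 powr j * (2 ^ B * lo)"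
      using ratio_less lo_pos \<epsilon> by (simp add: field_simps)
    finally show ?thesis by (simp add: mult_ac)
  qed
  show "0 < B" by (rule B_pos)
  show "card V < 2 ^ B" by (rule card_less)
  show "0 < \<delta>" using \<epsilon> B_pos by (simp add: tolerance_def)
  show "\<delta> * real (8 * B ^ 3) \<le> 1" using \<epsilon> B_pos by (simp add: tolerance_def field_simps)
  show "real (B * card V) < (1 + 1 / real (8 * B\<^sup>2)) ^ N" using depth_large by simp
qed

sublocale scale: leveled f V "\<lambda>v. 2 powr real_of_int j * w v" "2 powr real_of_int j * lo" B N \<delta> "U j"
  for j :: int
  by (rule leveled_scale)

abbreviation "\<kappa> \<equiv> leveled.rate B N \<delta>"
abbreviation "surplus \<equiv> leveled.surplus B \<delta>"

section \<open>All thresholds together: invariant and amortized queries\<close>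

definition sound :: "nat set \<Rightarrow> (int \<Rightarrow> level list) \<Rightarrow> bool" where
  "sound W L \<longleftrightarrow> (\<forall>j. scale.coherent j W N {} (U j) (L j))"

lemma pot_U: "scale.pot j {} (U j) < (1 + 1 / (8 * real B ^ 2)) ^ N"
proof -
  have "scale.pot j {} (U j) \<le> B * card (U j)" by (rule scale.pot_le)
  also have "\<dots> \<le> B * card V"
    using finite_V by (auto simp: U_def intro!: mult_left_mono card_mono)
  also have "\<dots> < (1 + 1 / (8 * real B ^ 2)) ^ N" using depth_large by simp
  finally show ?thesis .
qed

lemma sound_initial: "sound {} (\<lambda>_. [Level {} {} 0 {}])"
  unfolding sound_def by (intro allI scale.coherent_Nil_level pot_U) auto

lemma relevant_iff: "x \<in> V \<Longrightarrow> j \<in> relevant V w \<epsilon> x (f {x} - f {}) \<longleftrightarrow> x \<in> U j"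
  by (simp add: U_def)

lemma runs_refresh_scale:
  assumes "x \<in> U j" "scale.coherent j W N {} (U j) ls" "W' - {x} = W - {x}"
  shows "runs f (refresh_scale V w \<epsilon> x W' j ls) (\<lambda>q ls'. scale.coherent j W' N {} (U j) ls' \<and>
    q + \<kappa> * spent ls' \<le> \<kappa> * (spent ls + Suc N))"
proof -
  have "length ls \<le> Suc N" using scale.coherent_length[OF assms(2)] by simp
  moreover have "0 \<le> \<kappa>" using scale.\<delta>_pos by (simp add: scale.rate_def)
  ultimately have "\<kappa> * (spent ls + length ls) \<le> \<kappa> * (spent ls + Suc N)"
    by (intro mult_left_mono) auto
  moreover have "runs f (refresh_scale V w \<epsilon> x W' j ls) (\<lambda>q ls'. scale.coherent j W' N {} (U j) ls' \<and>
    q + \<kappa> * spent ls' \<le> \<kappa> * (spent ls + length ls))"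
    unfolding refresh_scale_def by (rule scale.runs_refresh) (use assms pot_U in auto)
  ultimately show ?thesis by (elim runs_mono) auto
qed

definition all_scales :: "int set" where
  "all_scales = (\<Union>x\<in>V. relevant V w \<epsilon> x (f {x} - f {}))"

text \<open>The sum may have as many as \<open>B * card V\<close> terms, but an update affects only
  the thresholds relevant to its element, so this number stays out of
  \<open>per_update\<close>.\<close>

definition budget :: "(int \<Rightarrow> level list) \<Rightarrow> real" where
  "budget L = (\<Sum>j\<in>all_scales. \<kappa> * spent (L j))"

definition per_update :: real where
  "per_update = 3 + B + B * (\<kappa> * Suc N)"

definition outcome :: "nat set \<Rightarrow> (int \<Rightarrow> level list) \<Rightarrow> nat set" where
  "outcome W L = (if (1 - \<epsilon>) * f W \<le> f {} then {}
     else total (L (choose_scale V w \<epsilon> (f W) f L)) \<inter> W)"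

lemma finite_all_scales: "finite all_scales"
  using relevant_bounded finite_V by (auto simp: all_scales_def)

lemma present_diff: "present up W - {upd_elem up} = W - {upd_elem up}"
  by (cases up) (auto simp: present_def)

lemma step_result:
  fixes up W
  defines "x \<equiv> upd_elem up" and "W' \<equiv> present up W"
  shows "runs f (step V w \<epsilon> up (W, L, S)) Q \<longleftrightarrow>
      runs f (update_all (refresh_scale V w \<epsilon> x W') (sorted_list_of_set (relevant V w \<epsilon> x (f {x} - f {}))) L)
        (\<lambda>q L'. Q (3 + q + card (guesses V w \<epsilon> (f W'))) (W', L', outcome W' L'))" (is ?th1)
    and "result f (step V w \<epsilon> up (W, L, S)) = map_pmf (\<lambda>L'. (W', L', outcome W' L'))
      (result f (update_all (refresh_scale V w \<epsilon> x W')
         (sorted_list_of_set (relevant V w \<epsilon> x (f {x} - f {}))) L))" (is ?th2)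
proof -
  have fg: "finite (guesses V w \<epsilon> (f W'))" using guesses_bounded by blast
  have ch: "choose_scale V w \<epsilon> (f W') (answers f (map (\<lambda>j. total (L' j)) (sorted_list_of_set (guesses V w \<epsilon> (f W'))))) L'
      = choose_scale V w \<epsilon> (f W') f L'" for L'
    unfolding choose_scale_def
    by (rule arg_cong[where f = Max]) (use fg in \<open>auto simp: answers_def\<close>)
  have a: "answers f [{}, {x}, W'] {} = f {}" "answers f [{}, {x}, W'] {x} = f {x}"
    "answers f [{}, {x}, W'] W' = f W'"
    by (auto simp: answers_def)
  note s = step_def Let_def x_def[symmetric] W'_def[symmetric] prod.case
  show ?th1
    unfolding s runs_bind runs_query_all runs_Ret a ch outcome_def[symmetric]
    using fg by (simp add: numeral_3_eq_3)
  show ?th2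
    unfolding s result_bind result_query_all result_Ret bind_return_pmf a ch outcome_def[symmetric]
    by (simp add: map_pmf_def)
qed

lemma runs_step:
  assumes x: "upd_elem up \<in> V" and ok: "sound W L"
  shows "runs f (step V w \<epsilon> up (W, L, S)) (\<lambda>q (W', L', S').
    W' = present up W \<and> sound W' L' \<and> S' = outcome W' L' \<and> q + budget L' \<le> budget L + per_update)"
proof -
  define x where "x = upd_elem up"
  define W' where "W' = present up W"
  define R where "R = relevant V w \<epsilon> x (f {x} - f {})"
  have xV: "x \<in> V" using x by (simp add: x_def)
  have R: "finite R" "card R \<le> B" "R \<subseteq> all_scales"
    using relevant_bounded[OF xV] xV by (auto simp: R_def all_scales_def)
  have RU: "j \<in> R \<longleftrightarrow> x \<in> U j" for j using relevant_iff[OF xV] by (simp add: R_def)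
  have "0 \<le> \<kappa>" using scale.\<delta>_pos by (simp add: scale.rate_def)
  then have \<kappa>N: "0 \<le> \<kappa> * Suc N" by simp
  have WW: "W' - {x} = W - {x}" by (simp add: W'_def x_def present_diff)
  have "runs f (update_all (refresh_scale V w \<epsilon> x W') (sorted_list_of_set R) L) (\<lambda>q L'.
      (\<forall>j. j \<notin> set (sorted_list_of_set R) \<longrightarrow> L' j = L j) \<and>
      (\<exists>k :: int \<Rightarrow> nat. (\<forall>j\<in>set (sorted_list_of_set R). scale.coherent j W' N {} (U j) (L' j) \<and>
        real (k j) + \<kappa> * spent (L' j) \<le> \<kappa> * (spent (L j) + Suc N)) \<and> q = sum k (set (sorted_list_of_set R))))"
    using R ok RU WW by (intro runs_update_all runs_refresh_scale[of x _ W]) (auto simp: sound_def)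
  then have "runs f (update_all (refresh_scale V w \<epsilon> x W') (sorted_list_of_set R) L) (\<lambda>q L'.
      sound W' L' \<and>
      (3 + q + card (guesses V w \<epsilon> (f W'))) + budget L' \<le> budget L + per_update)"
  proof (rule runs_mono, unfold set_sorted_list_of_set[OF R(1)], elim conjE exE, intro conjI)
    fix q L' k
    assume L': "\<forall>j. j \<notin> R \<longrightarrow> L' j = L j"
      and k: "\<forall>j\<in>R. scale.coherent j W' N {} (U j) (L' j) \<and>
        real (k j) + \<kappa> * spent (L' j) \<le> \<kappa> * (spent (L j) + Suc N)" and q: "q = sum k R"
    show "sound W' L'"
      unfolding sound_def
    proof
      fix j show "scale.coherent j W' N {} (U j) (L' j)"
      proof (cases "j \<in> R")
        case True
        then show ?thesis using k by blast
      next
        case False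
        then have "x \<notin> U j" using RU by blast
        then have "W' \<inter> U j = W \<inter> U j" using WW by blast
        moreover have "scale.coherent j W N {} (U j) (L j)" using ok by (simp add: sound_def)
        ultimately show ?thesis using L' False scale.coherent_irrelevant[of j W N "{}" "U j" "L j" W'] by auto
      qed
    qed
    \<comment> \<open>A refreshed threshold pays its \<open>k j\<close> queries from the budget and
      deposits at most \<open>\<kappa> * Suc N\<close>.\<close>
    have "budget L' \<le> (\<Sum>j\<in>all_scales. \<kappa> * spent (L j) + (if j \<in> R then \<kappa> * Suc N - k j else 0))"
      unfolding budget_def
    proof (rule sum_mono)
      fix j
      show "\<kappa> * spent (L' j) \<le> \<kappa> * spent (L j) + (if j \<in> R then \<kappa> * Suc N - k j else 0)"
      proof (cases "j \<in> R")
        case True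
        then have "real (k j) + \<kappa> * spent (L' j) \<le> \<kappa> * (spent (L j) + Suc N)" using k by blast
        then show ?thesis using True by (simp add: distrib_left)
      next
        case False
        then show ?thesis using L' by simp
      qed
    qed
    also have "\<dots> = budget L + (\<Sum>j\<in>R. \<kappa> * Suc N - k j)"
      using finite_all_scales R
      by (simp add: sum.distrib budget_def sum.If_cases Int_absorb1)
    also have "\<dots> = budget L + card R * (\<kappa> * Suc N) - q"
      by (simp add: sum_subtractf q)
    also have "\<dots> \<le> budget L + B * (\<kappa> * Suc N) - q"
      using R(2) \<kappa>N mult_right_mono[of "real (card R)" "real B" "\<kappa> * Suc N"] by simp
    finally have "budget L' \<le> budget L + B * (\<kappa> * Suc N) - q" .
    moreover have "real (card (guesses V w \<epsilon> (f W'))) \<le> B" using guesses_bounded by simp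
    ultimately show "real (3 + q + card (guesses V w \<epsilon> (f W'))) + budget L' \<le> budget L + per_update"
      by (simp add: per_update_def)
  qed
  then show ?thesis
    by (simp add: step_result(1) x_def[symmetric] W'_def[symmetric] R_def[symmetric] add.assoc)
qed

lemma step_marginal:
  assumes x: "upd_elem up \<in> V"
  shows "map_pmf (\<lambda>s. fst (snd s) j) (result f (step V w \<epsilon> up (W, L, S))) =
    (if upd_elem up \<in> U j then result f (refresh_scale V w \<epsilon> (upd_elem up) (present up W) j (L j))
     else return_pmf (L j))"
  using relevant_bounded[OF x] relevant_iff[OF x]
  by (simp add: step_result(2) map_pmf_comp result_update_all)

lemma expects_refresh_scale:
  assumes "x \<in> U j" "finite F" "scale.coherent j W N {} (U j) ls"
  shows "expects f (refresh_scale V w \<epsilon> x W' j ls) (surplus F) (surplus (insert x F) ls)"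
  unfolding refresh_scale_def using assms by (intro scale.expects_refresh) auto

lemma finite_step:
  assumes x: "upd_elem up \<in> V" and ok: "sound W L"
  shows "finite (set_pmf (result f (step V w \<epsilon> up (W, L, S))))"
proof -
  let ?x = "upd_elem up"
  have "finite (set_pmf (result f (refresh_scale V w \<epsilon> ?x (present up W) j (L j))))" if "?x \<in> U j" for j
    using expects_refresh_scale[of ?x j "{}" W "L j"] that ok by (auto simp: expects_def sound_def)
  then show ?thesis
    using relevant_bounded[OF x] relevant_iff[OF x]
    by (auto simp: step_result(2) intro!: finite_imageI finite_update_all)
qed

lemma expectation_step:
  assumes x: "upd_elem up \<in> V" and ok: "sound W L" and F: "finite F"
  shows "measure_pmf.expectation (result f (step V w \<epsilon> up (W, L, S))) (\<lambda>s. surplus F (fst (snd s) j))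
    \<le> surplus (if upd_elem up \<in> U j then insert (upd_elem up) F else F) (L j)"
proof -
  have "measure_pmf.expectation (result f (step V w \<epsilon> up (W, L, S))) (\<lambda>s. surplus F (fst (snd s) j))
    = measure_pmf.expectation (map_pmf (\<lambda>s. fst (snd s) j) (result f (step V w \<epsilon> up (W, L, S)))) (surplus F)"
    by simp
  also have "\<dots> \<le> surplus (if upd_elem up \<in> U j then insert (upd_elem up) F else F) (L j)"
    unfolding step_marginal[OF x]
    using expects_refresh_scale[of "upd_elem up" j F W "L j"] ok F by (auto simp: expects_def sound_def)
  finally show ?thesis .
qed

section \<open>Cost and value of the output in a given state\<close>

lemma OPT_attained:
  assumes "W \<subseteq> V"
  obtains S where "S \<subseteq> W" "f S = f W" "OPT f w W = cost w S"
proof -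
  have "finite W" using assms finite_V finite_subset by blast
  then have "finite (cost w ` {S. S \<subseteq> W \<and> f S = f W})" by simp
  moreover have "cost w ` {S. S \<subseteq> W \<and> f S = f W} \<noteq> {}" by blast
  ultimately have "OPT f w W \<in> cost w ` {S. S \<subseteq> W \<and> f S = f W}"
    unfolding OPT_def by (rule Min_in)
  then show thesis using that by auto
qed

lemma cost_nonneg: "S \<subseteq> V \<Longrightarrow> 0 \<le> cost w S"
  unfolding cost_def using w_pos by (intro sum_nonneg) (auto intro: less_imp_le)

lemma total_sub: "sound W L \<Longrightarrow> total (L j) \<subseteq> V"
  using scale.coherent_total_sub[of j W N "{}" "U j" "L j"] scale.U_sub[of j] by (auto simp: sound_def)

text \<open>Each element of \<open>S\<close> adds at most \<open>2 powr j\<close> times its weight.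
  Inside \<open>U j\<close> this holds as it is not live. Outside, its singleton gain is already
  that small: since this gain is at most \<open>f W\<close>, the premise on \<open>j\<close> gives
  the lower end of \<open>relevant\<close>, so a positive gain must violate the upper end.\<close>

lemma coverage:
  assumes ok: "sound W L" and W: "W \<subseteq> V" and S: "S \<subseteq> W" "f S = f W"
    and j: "\<epsilon> * f W \<le> 2 powr j * (2 * card V * hi)"
  shows "f W - 2 powr j * cost w S \<le> f (total (L j))"
proof -
  let ?T = "total (L j)"
  have TV: "?T \<subseteq> V" using total_sub ok by blast
  have SV: "S \<subseteq> V" using S W by blast
  have each: "f (insert v ?T) - f ?T \<le> 2 powr j * w v" if v: "v \<in> S" for v
  proof (cases "v \<in> U j")
    case True
    have "\<not> live f (\<lambda>v. 2 powr j * w v) ({} \<union> ?T) v"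
      using ok v S True by (intro scale.coherent_not_live[of j W N "{}" "U j"]) (auto simp: sound_def)
    then show ?thesis by (simp add: live_def)
  next
    case False
    let ?y = "f {v} - f {}"
    have vV: "v \<in> V" using v SV by blast
    have le: "f (insert v ?T) - f ?T \<le> ?y" using gain_singleton_le[OF vV TV] .
    have "?y \<le> 2 powr j * w v"
    proof (cases "0 < ?y")
      case True
      have "?y \<le> f W" using nonneg[of "{}"] mono[of "{v}" W] v S W by force
      then have "\<epsilon> * ?y \<le> \<epsilon> * f W" using \<epsilon> by simp
      then have "\<epsilon> * ?y / (2 * card V * hi) \<le> 2 powr j"
        using j hi_pos card_pos by (simp add: divide_le_eq)
      then have "\<not> 2 powr j \<le> ?y / w v"
        using False vV True by (auto simp: U_def relevant_def scales_def)
      then show ?thesis using w_pos[OF vV] by (simp add: field_simps)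
    next
      case False
      moreover have "0 \<le> 2 powr real_of_int j * w v" using w_pos[OF vV] by simp
      ultimately show ?thesis by linarith
    qed
    then show ?thesis using le by linarith
  qed
  have "f W \<le> f (?T \<union> S)" using S(2) mono[of S "?T \<union> S"] TV SV by simp
  moreover have "f (?T \<union> S) - f ?T \<le> (\<Sum>v\<in>S. f (insert v ?T) - f ?T)"
    using TV SV by (intro union_le_sum_gains) auto
  moreover have "\<dots> \<le> 2 powr j * cost w S"
    unfolding cost_def sum_distrib_left using each by (intro sum_mono)
  ultimately show ?thesis by linarith
qed

lemma outcome_correct:
  assumes ok: "sound W L" and W: "W \<subseteq> V"
  shows "outcome W L \<subseteq> W" "cost w (outcome W L) \<le> 2 / \<epsilon> * OPT f w W"
    "(1 - \<epsilon>) * f W - (\<Sum>j\<in>guesses V w \<epsilon> (f W). f (total (L j)) - f (total (L j) \<inter> W))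
      \<le> f (outcome W L)"
proof -
  show "outcome W L \<subseteq> W" by (auto simp: outcome_def)
  obtain O' where O': "O' \<subseteq> W" "f O' = f W" and opt: "OPT f w W = cost w O'"
    using OPT_attained[OF W] .
  let ?G = "guesses V w \<epsilon> (f W)"
  let ?d = "\<lambda>j. f (total (L j)) - f (total (L j) \<inter> W)"
  have finG: "finite ?G" using guesses_bounded by blast
  have d: "0 \<le> ?d j" for j using mono[of "total (L j) \<inter> W" "total (L j)"] total_sub[OF ok] by auto
  have OV: "O' \<subseteq> V" using O' W by blast
  have "cost w (outcome W L) \<le> 2 / \<epsilon> * OPT f w W \<and>
    (1 - \<epsilon>) * f W - (\<Sum>j\<in>?G. ?d j) \<le> f (outcome W L)"
  proof (cases "(1 - \<epsilon>) * f W \<le> f {}")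
    case True
    have "0 \<le> 2 / \<epsilon> * OPT f w W" using opt cost_nonneg[OF OV] \<epsilon> by simp
    moreover have "0 \<le> (\<Sum>j\<in>?G. ?d j)" using d by (simp add: sum_nonneg)
    ultimately show ?thesis using True by (simp add: outcome_def cost_def)
  next
    \<comment> \<open>Now \<open>f W\<close> is positive and exceeds \<open>f {}\<close>, so an
      optimal set is nonempty with positive cost, as the logarithm below requires.\<close>
    case False
    define F where "F = f W"
    have f0: "0 \<le> f {}" by (rule nonneg) simp
    then have "0 < (1 - \<epsilon>) * F" using False by (simp add: F_def)
    then have F: "0 < F" using \<epsilon> by (simp add: zero_less_mult_iff)
    have "(1 - \<epsilon>) * F \<le> 1 * F" using F \<epsilon> by (intro mult_right_mono) auto
    then have "f {} < F" using False by (simp add: F_def)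
    then have "O' \<noteq> {}" using O' by (auto simp: F_def)
    then obtain v where v: "v \<in> O'" by blast
    have finO: "finite O'" using OV finite_V finite_subset by blast
    define c where "c = cost w O'"
    have "lo \<le> w v" using v OV by (intro lo_le) auto
    also have "\<dots> \<le> c"
      unfolding c_def cost_def using v OV w_pos finO by (intro member_le_sum) (auto intro: less_imp_le)
    finally have lo_c: "lo \<le> c" .
    then have c: "0 < c" using lo_pos by linarith
    have "c \<le> (\<Sum>v\<in>O'. hi)" unfolding c_def cost_def using OV le_hi by (intro sum_mono) auto
    also have "\<dots> \<le> card V * hi"
      using card_mono[OF finite_V OV] hi_pos by (simp add: mult_right_mono)
    finally have c_hi: "c \<le> card V * hi" .
    \<comment> \<open>The ideal threshold for the optimal cost \<open>c\<close>, rounded down to a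
      power of two; the rounding is the source of the 2 in \<open>2 / \<epsilon>\<close>.\<close>
    define j0 where "j0 = \<lfloor>log 2 (\<epsilon> * F / c)\<rfloor>"
    have pos: "0 < \<epsilon> * F / c" using \<epsilon> F c by simp
    have plog: "2 powr (log 2 (\<epsilon> * F / c)) = \<epsilon> * F / c" using pos by simp
    have "2 powr real_of_int j0 \<le> 2 powr (log 2 (\<epsilon> * F / c))" unfolding j0_def by (intro powr_mono) auto
    then have j0_le: "2 powr j0 * c \<le> \<epsilon> * F" unfolding plog using c by (simp only: pos_le_divide_eq)
    have "2 powr (log 2 (\<epsilon> * F / c)) < 2 powr (real_of_int j0 + 1)"
      unfolding j0_def by (intro powr_less_mono) auto
    then have "\<epsilon> * F < 2 powr (real_of_int j0 + 1) * c" unfolding plog using c by (simp only: pos_divide_less_eq)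
    then have j0_ge: "\<epsilon> * F < 2 * 2 powr j0 * c" by (simp add: powr_add mult_ac)
    have "2 * 2 powr real_of_int j0 * c \<le> 2 * 2 powr real_of_int j0 * (card V * hi)"
      using c_hi by (intro mult_left_mono) auto
    then have "\<epsilon> * F \<le> 2 * 2 powr real_of_int j0 * (card V * hi)" using j0_ge by linarith
    then have j0_hi: "\<epsilon> * F \<le> 2 powr j0 * (2 * card V * hi)" by (simp add: mult_ac)
    have "2 powr real_of_int j0 * lo \<le> 2 powr real_of_int j0 * c" using lo_c by (intro mult_left_mono) auto
    then have j0_lo: "2 powr j0 * lo \<le> \<epsilon> * F" using j0_le by linarith
    have "j0 \<in> ?G"
      using F j0_hi j0_lo lo_pos hi_pos card_pos
      by (simp add: guesses_def scales_def F_def divide_le_eq le_divide_eq)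
    moreover have "f W - 2 powr j0 * cost w O' \<le> f (total (L j0))"
      using j0_hi O' by (intro coverage[OF ok W]) (auto simp: F_def)
    then have "(1 - \<epsilon>) * f W \<le> f (total (L j0))"
      using j0_le by (simp add: c_def F_def algebra_simps)
    ultimately have j0: "j0 \<in> {j \<in> ?G. (1 - \<epsilon>) * f W \<le> f (total (L j))}" by blast
    define j where "j = choose_scale V w \<epsilon> (f W) f L"
    have "j \<in> {j \<in> ?G. (1 - \<epsilon>) * f W \<le> f (total (L j))}"
      unfolding j_def choose_scale_def using finG j0 by (intro Max_in) auto
    then have j: "j \<in> ?G" "(1 - \<epsilon>) * f W \<le> f (total (L j))" by auto
    \<comment> \<open>The guess \<open>j0\<close> passes the test, so the chosen threshold is no
      smaller and its cost bound no worse.\<close>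
    have "j0 \<le> j" unfolding j_def choose_scale_def using finG j0 by (intro Max_ge) auto
    then have pj: "2 powr real_of_int j0 \<le> 2 powr real_of_int j" by (intro powr_mono) auto
    have out: "outcome W L = total (L j) \<inter> W" using False by (simp add: outcome_def j_def)
    have coherent: "scale.coherent j W N {} (U j) (L j)" using ok by (simp add: sound_def)
    have "f {} + (\<Sum>v\<in>outcome W L. 2 powr j * w v) \<le> f ({} \<union> outcome W L)"
      unfolding out using coherent by (intro scale.coherent_kept_gain) auto
    moreover have "f (outcome W L) \<le> F" unfolding F_def using W out by (intro mono) auto
    ultimately have "2 powr j * cost w (outcome W L) \<le> F"
      using f0 by (simp add: cost_def sum_distrib_left)
    moreover have "2 powr real_of_int j0 * cost w (outcome W L) \<le> 2 powr real_of_int j * cost w (outcome W L)"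
      using pj out W by (intro mult_right_mono cost_nonneg) auto
    ultimately have "2 powr j0 * cost w (outcome W L) \<le> F" by linarith
    then have "\<epsilon> * (2 powr j0 * cost w (outcome W L)) \<le> \<epsilon> * F" using \<epsilon> by simp
    moreover have "2 powr j0 * (\<epsilon> * cost w (outcome W L)) = \<epsilon> * (2 powr j0 * cost w (outcome W L))"
      "2 powr j0 * (2 * c) = 2 * 2 powr j0 * c"
      by (simp_all only: mult_ac)
    ultimately have "2 powr j0 * (\<epsilon> * cost w (outcome W L)) < 2 powr j0 * (2 * c)"
      using j0_ge by linarith
    then have "\<epsilon> * cost w (outcome W L) < 2 * c" by simp
    then have "cost w (outcome W L) \<le> 2 / \<epsilon> * OPT f w W"
      using \<epsilon> opt by (simp add: c_def field_simps)
    moreover have "?d j \<le> (\<Sum>j\<in>?G. ?d j)" using finG j(1) d by (intro member_le_sum) auto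
    then have "(1 - \<epsilon>) * f W - (\<Sum>j\<in>?G. ?d j) \<le> f (outcome W L)" using j(2) out by simp
    ultimately show ?thesis ..
  qed
  then show "cost w (outcome W L) \<le> 2 / \<epsilon> * OPT f w W"
    "(1 - \<epsilon>) * f W - (\<Sum>j\<in>?G. ?d j) \<le> f (outcome W L)" by auto
qed

end

section \<open>Expectations along a fixed update sequence\<close>

locale cover_updates = cover +
  fixes u :: "nat \<Rightarrow> upd"
  assumes u: "\<And>t. upd_elem (u t) \<in> V"
begin

abbreviation "run \<equiv> exec_state f (step V w \<epsilon>) initial u"
abbreviation "states t \<equiv> map_pmf snd (run t)"

lemma cur_sub: "cur u t \<subseteq> V"
proof (induction t)
  case (Suc t)
  then show ?case using u[of t] by (cases "u t") auto
qed simp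

lemma cur_Suc: "cur u (Suc t) = present (u t) (cur u t)"
  by (simp add: present_def)

lemma run_invariant:
  assumes run: "(tr, (W, L, S)) \<in> set_pmf (run t)"
  shows "W = cur u t" "sound W L" "num_queries tr + budget L \<le> t * per_update"
    "0 < t \<Longrightarrow> S = outcome W L"
proof -
  define I where "I t n s = (case s of (W, L, S) \<Rightarrow> W = cur u t \<and> sound W L \<and>
     real n + budget L \<le> real t * per_update \<and> (0 < t \<longrightarrow> S = outcome W L))"
    for t n and s :: state
  have "I 0 0 initial"
    using sound_initial by (simp add: I_def initial_def budget_def)
  moreover have "runs f (step V w \<epsilon> (u t) s) (\<lambda>m. I (Suc t) (n + m))" if "I t n s" for t n s
  proof -
    obtain W L S where s: "s = (W, L, S)" by (cases s)
    have *: "W = cur u t" "sound W L" "real n + budget L \<le> real t * per_update"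
      using that by (auto simp: I_def s)
    show ?thesis
      unfolding s by (rule runs_mono[OF runs_step[OF u *(2)]])
        (use * in \<open>auto simp: I_def cur_Suc algebra_simps simp del: cur.simps\<close>)
  qed
  ultimately have "I t (num_queries tr) (W, L, S)"
    using exec_state_invariant[of I initial f "step V w \<epsilon>" u, OF _ _ run] by blast
  then show "W = cur u t" "sound W L" "num_queries tr + budget L \<le> t * per_update"
    "0 < t \<Longrightarrow> S = outcome W L"
    unfolding I_def prod.case by blast+
qed

lemma states_invariant:
  assumes "s \<in> set_pmf (states t)"
  obtains W L S where "s = (W, L, S)" "W = cur u t" "sound W L" "0 < t \<longrightarrow> S = outcome W L"
proof -
  obtain W L S where s: "s = (W, L, S)" by (cases s)
  with assms obtain tr where "(tr, (W, L, S)) \<in> set_pmf (run t)" by auto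
  then show thesis using that[OF s] run_invariant[of tr W L S t] by blast
qed

lemma finite_states: "finite (set_pmf (states t))"
proof (induction t)
  case 0
  then show ?case by simp
next
  case (Suc t)
  have "finite (set_pmf (result f (step V w \<epsilon> (u t) s)))" if s: "s \<in> set_pmf (states t)" for s
    using states_invariant[OF s] finite_step[OF u] by metis
  then show ?case unfolding states_exec_state set_bind_pmf by (intro finite_UN_I Suc.IH)
qed

text \<open>Obliviousness enters here: \<open>future t\<close> is read off \<open>u\<close>, not off
  the run. It is \<open>future (Suc t)\<close> plus the current element if that lies in
  \<open>U j\<close>, matching one step of the supermartingale. At \<open>t = T\<close> it is empty,
  and the surplus becomes the actual loss minus \<eta> times the gain.\<close>

lemma expectation_surplus_le:
  fixes T j
  defines "future t \<equiv> {x \<in> U j. \<exists>i. t \<le> i \<and> i < T \<and> upd_elem (u i) = x}"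
  shows "t \<le> T \<Longrightarrow> measure_pmf.expectation (states t) (\<lambda>s. surplus (future t) (fst (snd s) j)) \<le> 0"
proof (induction t)
  case 0
  then show ?case by (simp add: initial_def scale.surplus.simps)
next
  case (Suc t)
  have fin: "finite (future t')" for t'
    using scale.finite_U[of j] by (simp add: future_def)
  have fut: "(if upd_elem (u t) \<in> U j then insert (upd_elem (u t)) (future (Suc t)) else future (Suc t)) = future t"
  proof -
    have "(\<exists>i. t \<le> i \<and> i < T \<and> upd_elem (u i) = x) \<longleftrightarrow>
        x = upd_elem (u t) \<or> (\<exists>i. Suc t \<le> i \<and> i < T \<and> upd_elem (u i) = x)" for x
      using Suc.prems by (metis Suc_leD Suc_le_eq le_neq_implies_less order_refl)
    then show ?thesis by (auto simp: future_def)
  qed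
  have "measure_pmf.expectation (states (Suc t)) (\<lambda>s. surplus (future (Suc t)) (fst (snd s) j))
    \<le> measure_pmf.expectation (states t) (\<lambda>s. surplus (future t) (fst (snd s) j))"
    unfolding states_exec_state
  proof (rule expectation_bind_le[OF finite_states])
    fix s assume "s \<in> set_pmf (states t)"
    then obtain W L S where s: "s = (W, L, S)" "sound W L" by (rule states_invariant)
    show "finite (set_pmf (result f (step V w \<epsilon> (u t) s)))"
      unfolding s(1) by (rule finite_step[OF u s(2)])
    show "measure_pmf.expectation (result f (step V w \<epsilon> (u t) s))
        (\<lambda>s. surplus (future (Suc t)) (fst (snd s) j)) \<le> surplus (future t) (fst (snd s) j)"
      using expectation_step[OF u s(2) fin, of t S "Suc t" j] unfolding fut by (simp add: s(1))
  qed
  then show ?case using Suc by simp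
qed

lemma \<eta>_bounds: "16 * (\<delta> * B) \<le> 1 / 2" "B * (2 * (16 * (\<delta> * B))) \<le> \<epsilon>"
proof -
  have B: "1 \<le> real B" using B_pos by simp
  have e: "16 * (\<delta> * B) = \<epsilon> / (2 * real B ^ 2)"
    using B by (simp add: tolerance_def power3_eq_cube power2_eq_square)
  have "1 \<le> real B ^ 2" using B by (rule one_le_power)
  then show "16 * (\<delta> * B) \<le> 1 / 2" unfolding e using \<epsilon> by (simp add: divide_le_eq)
  have "B * (2 * (16 * (\<delta> * B))) = \<epsilon> / B" unfolding e using B by (simp add: power2_eq_square)
  also have "\<dots> \<le> \<epsilon>" using B \<epsilon> by (simp add: divide_le_eq)
  finally show "B * (2 * (16 * (\<delta> * B))) \<le> \<epsilon>" .
qed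

text \<open>The selected threshold depends on the random choices, so the losses are summed over all guesses.\<close>

lemma expectation_outcome:
  assumes t: "0 < t"
  shows "(1 - 2 * \<epsilon>) * f (cur u t) \<le> measure_pmf.expectation (states t) (\<lambda>s. f (snd (snd s)))"
proof -
  define F where "F = f (cur u t)"
  define G where "G = guesses V w \<epsilon> F"
  define \<eta> where "\<eta> = 16 * (\<delta> * B)"
  let ?E = "measure_pmf.expectation (states t)"
  have F: "0 \<le> F" unfolding F_def using cur_sub by (rule nonneg)
  have G: "finite G" "card G \<le> B" using guesses_bounded by (auto simp: G_def)
  have int: "integrable (measure_pmf (states t)) g" for g :: "state \<Rightarrow> real"
    by (rule integrable_measure_pmf_finite[OF finite_states])
  have E: "?E (\<lambda>s. surplus {} (fst (snd s) j)) \<le> 0" for j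
  proof -
    have "{x \<in> U j. \<exists>i. t \<le> i \<and> i < t \<and> upd_elem (u i) = x} = {}" by auto
    then show ?thesis using expectation_surplus_le[of t t j] by (simp only: order_refl simp_thms)
  qed
  have "(1 - 2 * \<epsilon>) * F \<le> (1 - \<epsilon>) * F - card G * (2 * \<eta> * F)"
  proof -
    have "0 \<le> \<eta>" using scale.\<delta>_pos by (simp add: \<eta>_def)
    then have "card G * (2 * \<eta>) \<le> B * (2 * \<eta>)" using G(2) by (intro mult_right_mono) auto
    also have "\<dots> \<le> \<epsilon>" unfolding \<eta>_def by (rule \<eta>_bounds)
    finally have "card G * (2 * \<eta>) * F \<le> \<epsilon> * F" using F by (intro mult_right_mono)
    then show ?thesis by (simp add: algebra_simps)
  qed
  also have "\<dots> \<le> (1 - \<epsilon>) * F - (\<Sum>j\<in>G. 2 * ?E (\<lambda>s. surplus {} (fst (snd s) j)) + 2 * \<eta> * F)"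
  proof -
    have "(\<Sum>j\<in>G. 2 * ?E (\<lambda>s. surplus {} (fst (snd s) j)) + 2 * \<eta> * F) \<le> (\<Sum>j\<in>G. 2 * \<eta> * F)"
      using E by (intro sum_mono) simp
    then show ?thesis by simp
  qed
  \<comment> \<open>\<open>G\<close> depends only on \<open>f (cur u t)\<close>, so it is a fixed
    index set and linearity applies.\<close>
  also have "\<dots> = ?E (\<lambda>s. (1 - \<epsilon>) * F - (\<Sum>j\<in>G. 2 * surplus {} (fst (snd s) j) + 2 * \<eta> * F))"
    by (simp add: int del: integral_map_pmf integrable_map_pmf_eq sum.distrib)
  also have "\<dots> \<le> ?E (\<lambda>s. f (snd (snd s)))"
  proof (intro integral_mono_AE int, unfold AE_measure_pmf_iff, intro ballI)
    fix s assume "s \<in> set_pmf (states t)"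
    then obtain W L S where s: "s = (W, L, S)" "W = cur u t" "sound W L" "0 < t \<longrightarrow> S = outcome W L"
      by (rule states_invariant)
    from s(4) t have S: "S = outcome W L" by blast
    have W: "W \<subseteq> V" using s(2) cur_sub by blast
    have "f (total (L j)) - f (total (L j) \<inter> W) \<le> 2 * surplus {} (L j) + 2 * \<eta> * F" for j
      unfolding \<eta>_def F_def s(2)[symmetric]
      using s(3) W \<eta>_bounds(1) by (intro scale.coherent_kept_value) (auto simp: sound_def)
    then have "(\<Sum>j\<in>G. f (total (L j)) - f (total (L j) \<inter> W)) \<le> (\<Sum>j\<in>G. 2 * surplus {} (L j) + 2 * \<eta> * F)"
      by (intro sum_mono)
    moreover have "(1 - \<epsilon>) * F - (\<Sum>j\<in>G. f (total (L j)) - f (total (L j) \<inter> W)) \<le> f S"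
      unfolding S G_def F_def s(2)[symmetric] by (rule outcome_correct(3)[OF s(3) W])
    ultimately show "(1 - \<epsilon>) * F - (\<Sum>j\<in>G. 2 * surplus {} (fst (snd s) j) + 2 * \<eta> * F) \<le> f (snd (snd s))"
      by (simp add: s(1))
  qed
  finally show ?thesis by (simp add: F_def)
qed

text \<open>The degree 12 is \<open>1 + 8 + 3\<close>: up to \<open>B\<close> thresholds, \<kappa>
  with the cubic depth times a linear factor times \<open>1 / \<delta>\<close> of degree 4, and the
  cubic number of levels. The constant is \<open>16 * 5 * 34 * 17 + 4\<close>; natural logarithms
  and rounding cost a factor 3 per degree.\<close>

lemma per_update_le:
  "per_update \<le> 46244 * 3 ^ 12 * (1 + ln (card V) + ln (wratio w V) + 1 / \<epsilon>) ^ 12"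
proof -
  define X where "X = 1 + ln (card V) + ln (wratio w V) + 1 / \<epsilon>"
  define Y where "Y = 3 * X"
  have ln0: "0 \<le> ln (real (card V))" "0 \<le> ln (wratio w V)" using card_pos ratio_ge1 by auto
  have e1: "1 < 1 / \<epsilon>" using \<epsilon> by simp
  have X: "1 \<le> X" "1 / \<epsilon> \<le> X" using ln0 e1 by (auto simp: X_def)
  have Y: "1 \<le> Y" "1 / \<epsilon> \<le> Y" using X by (auto simp: Y_def)
  have BY: "B \<le> Y"
  proof -
    let ?r = "2 * card V * wratio w V / \<epsilon>"
    have "ln ?r = ln 2 + ln (card V) + ln (wratio w V) + ln (1 / \<epsilon>)"
      using card_pos ratio_ge1 \<epsilon> by (simp add: ln_mult ln_div)
    also have "\<dots> \<le> ln 2 + (X - 1)"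
      using ln_le_minus_one[of "1 / \<epsilon>"] \<epsilon> by (simp add: X_def)
    finally have lr: "ln ?r \<le> ln 2 + (X - 1)" .
    have l2: "1 / 2 \<le> ln (2 :: real)" using ln2_ge_two_thirds by simp
    have "log 2 ?r \<le> (ln 2 + (X - 1)) / ln 2"
      unfolding log_def using lr by (intro divide_right_mono) auto
    also have "\<dots> = 1 + (X - 1) / ln 2" by (simp add: add_divide_distrib)
    also have "(X - 1) / ln 2 \<le> (X - 1) / (1 / 2)"
      using l2 X by (intro divide_left_mono) auto
    finally have "log 2 ?r \<le> 2 * X - 1" by simp
    moreover have "0 \<le> 2 * X - 1" using X by simp
    moreover have "real B \<le> max 0 (log 2 ?r) + 2"
      unfolding num_scales_def by (simp add: max_def) linarith
    ultimately show "real B \<le> Y" using X by (simp add: Y_def max_def split: if_splits)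
  qed
  have B1: "1 \<le> real B" using B_pos by simp
  have Y0: "0 \<le> Y" using Y by simp
  have YY: "Y ^ m \<le> Y ^ n" if "m \<le> n" for m n using Y that by (intro power_increasing) auto
  have N: "real N \<le> 16 * Y ^ 3" unfolding depth_def using BY by (simp add: power_mono)
  have "1 / \<delta> = 32 * real B ^ 3 * (1 / \<epsilon>)" by (simp add: tolerance_def)
  also have "\<dots> \<le> 32 * Y ^ 3 * Y"
    using BY Y \<epsilon> by (intro mult_mono power_mono) auto
  finally have \<delta>: "1 / \<delta> \<le> 32 * Y ^ 4" by (simp add: eval_nat_numeral)
  have "1 / \<delta> + 2 \<le> 34 * Y ^ 4" using \<delta> YY[of 0 4] by simp
  moreover have "2 * real B + 3 \<le> 5 * Y" using BY Y by simp
  ultimately have "\<kappa> \<le> 16 * Y ^ 3 * (5 * Y * (34 * Y ^ 4))"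
    unfolding scale.rate_def using N Y0 scale.\<delta>_pos by (intro mult_mono) auto
  also have "\<dots> = 2720 * Y ^ 8" by (simp add: eval_nat_numeral)
  finally have \<kappa>: "\<kappa> \<le> 2720 * Y ^ 8" .
  have "real (Suc N) \<le> 17 * Y ^ 3" using N YY[of 0 3] by simp
  then have "B * (\<kappa> * Suc N) \<le> Y * (2720 * Y ^ 8 * (17 * Y ^ 3))"
    using \<kappa> BY Y0 scale.\<delta>_pos by (intro mult_mono) (auto simp: scale.rate_def)
  also have "\<dots> = 46240 * Y ^ 12" by (simp add: eval_nat_numeral)
  finally have "per_update \<le> 3 + Y + 46240 * Y ^ 12" using BY by (simp add: per_update_def)
  also have "\<dots> \<le> 46244 * Y ^ 12" using YY[of 0 12] YY[of 1 12] by simp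
  finally show ?thesis unfolding Y_def power_mult_distrib by (simp only: X_def mult.assoc)
qed

end

theorem theorem1:
  shows "\<exists>(C::real) (k::nat) (\<epsilon>0::real). C > 0 \<and> \<epsilon>0 > 0 \<and>
    (\<forall>\<epsilon>. 0 < \<epsilon> \<and> \<epsilon> < \<epsilon>0 \<longrightarrow>
      (\<exists>alg :: nat set \<Rightarrow> (nat \<Rightarrow> real) \<Rightarrow> event list \<Rightarrow> nat set comp.
        \<forall>V w f u. finite V \<and> V \<noteq> {} \<and> (\<forall>v\<in>V. w v > 0) \<and> monotone_submodular f V \<and>
                  (\<forall>t. upd_elem (u t) \<in> V) \<longrightarrow>
          (\<forall>t::nat. t \<ge> 1 \<longrightarrow>
             (\<forall>(tr, S) \<in> set_pmf (exec f (alg V w) u t).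
                 S \<subseteq> cur u t \<and> cost w S \<le> (C / \<epsilon>) * OPT f w (cur u t)) \<and>
             measure_pmf.expectation (exec f (alg V w) u t) (\<lambda>(tr, S). f S)
                 \<ge> (1 - C * \<epsilon>) * f (cur u t) \<and>
             (\<integral>\<^sup>+ x. ennreal (real (num_queries (fst x))) \<partial>measure_pmf (exec f (alg V w) u t))
                 \<le> ennreal (real t * (C * (1 + ln (real (card V)) + ln (wratio w V) + 1 / \<epsilon>) ^ k)))))"
proof -
  \<comment> \<open>The query bound dictates this value; cost and value only use
    \<open>2 \<le> C\<close>.\<close>
  define C :: real where "C = 46244 * 3 ^ 12"
  define alg where "alg \<epsilon> V w = stateful (step V w \<epsilon>) initial (\<lambda>s. snd (snd s))" for \<epsilon> V w
  have C: "2 \<le> C" by (simp add: C_def)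
  show ?thesis
  proof (rule exI[of _ C], rule exI[of _ 12], rule exI[of _ 1], intro conjI allI impI)
    show "0 < C" "(0 :: real) < 1" using C by auto
    fix \<epsilon> :: real
    assume \<epsilon>: "0 < \<epsilon> \<and> \<epsilon> < 1"
    show "\<exists>alg :: nat set \<Rightarrow> (nat \<Rightarrow> real) \<Rightarrow> event list \<Rightarrow> nat set comp.
        \<forall>V w f u. finite V \<and> V \<noteq> {} \<and> (\<forall>v\<in>V. w v > 0) \<and> monotone_submodular f V \<and>
                  (\<forall>t. upd_elem (u t) \<in> V) \<longrightarrow>
          (\<forall>t::nat. t \<ge> 1 \<longrightarrow>
             (\<forall>(tr, S) \<in> set_pmf (exec f (alg V w) u t).
                 S \<subseteq> cur u t \<and> cost w S \<le> (C / \<epsilon>) * OPT f w (cur u t)) \<and>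
             measure_pmf.expectation (exec f (alg V w) u t) (\<lambda>(tr, S). f S)
                 \<ge> (1 - C * \<epsilon>) * f (cur u t) \<and>
             (\<integral>\<^sup>+ x. ennreal (real (num_queries (fst x))) \<partial>measure_pmf (exec f (alg V w) u t))
                 \<le> ennreal (real t * (C * (1 + ln (real (card V)) + ln (wratio w V) + 1 / \<epsilon>) ^ 12)))"
    proof (intro exI[of _ "alg \<epsilon>"] allI impI)
      fix V :: "nat set" and w :: "nat \<Rightarrow> real" and f :: "nat set \<Rightarrow> real" and u :: "nat \<Rightarrow> upd" and t :: nat
      assume asm: "finite V \<and> V \<noteq> {} \<and> (\<forall>v\<in>V. w v > 0) \<and> monotone_submodular f V \<and>
                  (\<forall>t. upd_elem (u t) \<in> V)" and t: "1 \<le> t"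
      interpret cover_updates f V w \<epsilon> u by unfold_locales (use asm \<epsilon> in auto)
      have ex: "exec f (alg \<epsilon> V w) u t = map_pmf (\<lambda>(tr, s). (tr, snd (snd s))) (run t)"
        unfolding alg_def by (rule exec_stateful) (simp add: initial_def)
      have coherent: "W = cur u t" "sound W L" "real (num_queries tr) \<le> t * per_update" "S = outcome W L"
        if "(tr, (W, L, S)) \<in> set_pmf (run t)" for tr W L S
      proof -
        have "0 \<le> budget L"
          unfolding budget_def using scale.\<delta>_pos spent_nonneg
          by (intro sum_nonneg mult_nonneg_nonneg) (auto simp: scale.rate_def)
        then show "W = cur u t" "sound W L" "real (num_queries tr) \<le> t * per_update" "S = outcome W L"
          using run_invariant[OF that] t by auto
      qed
      have opt: "0 \<le> OPT f w (cur u t)"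
        using OPT_attained[OF cur_sub, of t] cost_nonneg cur_sub[of t] by (metis order_trans)
      show "(\<forall>(tr, S) \<in> set_pmf (exec f (alg \<epsilon> V w) u t).
                 S \<subseteq> cur u t \<and> cost w S \<le> (C / \<epsilon>) * OPT f w (cur u t)) \<and>
             measure_pmf.expectation (exec f (alg \<epsilon> V w) u t) (\<lambda>(tr, S). f S)
                 \<ge> (1 - C * \<epsilon>) * f (cur u t) \<and>
             (\<integral>\<^sup>+ x. ennreal (real (num_queries (fst x))) \<partial>measure_pmf (exec f (alg \<epsilon> V w) u t))
                 \<le> ennreal (real t * (C * (1 + ln (real (card V)) + ln (wratio w V) + 1 / \<epsilon>) ^ 12))"
      proof (intro conjI)
        have "S \<subseteq> cur u t \<and> cost w S \<le> (C / \<epsilon>) * OPT f w (cur u t)"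
          if "(tr, (W, L, S)) \<in> set_pmf (run t)" for tr W L S
        proof -
          note i = coherent[OF that]
          have "W \<subseteq> V" using i(1) cur_sub by blast
          note o = outcome_correct[OF i(2) this]
          have "2 / \<epsilon> * OPT f w W \<le> C / \<epsilon> * OPT f w W"
            using opt C \<epsilon> i(1) by (intro mult_right_mono divide_right_mono) auto
          then show ?thesis using o(1,2) unfolding i(4)[symmetric] i(1)[symmetric] by simp
        qed
        then show "\<forall>(tr, S) \<in> set_pmf (exec f (alg \<epsilon> V w) u t).
                 S \<subseteq> cur u t \<and> cost w S \<le> (C / \<epsilon>) * OPT f w (cur u t)"
          unfolding ex by fastforce
        have "(1 - C * \<epsilon>) * f (cur u t) \<le> (1 - 2 * \<epsilon>) * f (cur u t)"
          using C \<epsilon> nonneg[OF cur_sub] by (intro mult_right_mono) auto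
        also have "\<dots> \<le> measure_pmf.expectation (states t) (\<lambda>s. f (snd (snd s)))"
          using t by (intro expectation_outcome) simp
        finally show "(1 - C * \<epsilon>) * f (cur u t) \<le>
            measure_pmf.expectation (exec f (alg \<epsilon> V w) u t) (\<lambda>(tr, S). f S)"
          by (simp add: ex case_prod_unfold)
        have "real (num_queries tr) \<le> t * (C * (1 + ln (real (card V)) + ln (wratio w V) + 1 / \<epsilon>) ^ 12)"
          if "(tr, (W, L, S)) \<in> set_pmf (run t)" for tr W L S
        proof -
          have "t * per_update \<le> t * (C * (1 + ln (real (card V)) + ln (wratio w V) + 1 / \<epsilon>) ^ 12)"
            unfolding C_def by (intro mult_left_mono per_update_le) simp
          then show ?thesis using coherent(3)[OF that] by linarith
        qed
        then have "(\<integral>\<^sup>+ x. ennreal (real (num_queries (fst x))) \<partial>measure_pmf (exec f (alg \<epsilon> V w) u t))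
            \<le> (\<integral>\<^sup>+ x. ennreal (real t * (C * (1 + ln (real (card V)) + ln (wratio w V) + 1 / \<epsilon>) ^ 12))
                \<partial>measure_pmf (exec f (alg \<epsilon> V w) u t))"
          unfolding ex by (intro nn_integral_mono_AE) (auto simp: AE_measure_pmf_iff intro!: ennreal_leI)
        then show "(\<integral>\<^sup>+ x. ennreal (real (num_queries (fst x))) \<partial>measure_pmf (exec f (alg \<epsilon> V w) u t))
                 \<le> ennreal (real t * (C * (1 + ln (real (card V)) + ln (wratio w V) + 1 / \<epsilon>) ^ 12))"
          by (simp add: measure_pmf.emeasure_space_1)
      qed
    qed
  qed
qed

end
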